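(* Let $T_5$ be the $5$-regular tree. Then $\mathrm{md}(\mathrm{Aut}(T_5))=5$; in particular $T_5$ is a Cayley–Abels graph of minimal degree for $\mathrm{Aut}(T_5)$.
   Context: $\mathrm{Aut}(T_5)$ carries the permutation topology (pointwise stabilizers of finite vertex sets form a neighbourhood basis of the identity), making it a totally disconnected, locally compact group. A Cayley–Abels graph for such a group $G$ is a connected, locally finite simple graph with an action of $G$ by automorphisms (not necessarily faithful) that is vertex-transitive with compact open vertex stabilizers; $\mathrm{md}(G)$ is the minimal degree of such a graph. *)

theory Defs
  imports "HOL-Analysis.Analysis"
begin

text \<open>Concrete model of the 5-regular tree: vertices are reduced words over the
alphabet {0,...,4} (no two consecutive letters equal), i.e. the Cayley graph of the
free product of five copies of Z/2; w is adjacent to w@[a].\<close>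

definition T5_V :: "nat list set" where
  "T5_V = {w. set w \<subseteq> {..<5} \<and> (\<forall>i. Suc i < length w \<longrightarrow> w ! i \<noteq> w ! Suc i)}"

definition T5_adj :: "nat list \<Rightarrow> nat list \<Rightarrow> bool" where
  "T5_adj u v \<longleftrightarrow> u \<in> T5_V \<and> v \<in> T5_V \<and> (\<exists>a. v = u @ [a] \<or> u = v @ [a])"

definition graph_aut :: "'v set \<Rightarrow> ('v \<Rightarrow> 'v \<Rightarrow> bool) \<Rightarrow> ('v \<Rightarrow> 'v) \<Rightarrow> bool" where
  "graph_aut W E f \<longleftrightarrow> bij_betw f W W \<and> (\<forall>u\<in>W. \<forall>v\<in>W. E u v \<longleftrightarrow> E (f u) (f v))"

definition Aut_T5 :: "(nat list \<Rightarrow> nat list) set" where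
  "Aut_T5 = {f. graph_aut T5_V T5_adj f \<and> (\<forall>x. x \<notin> T5_V \<longrightarrow> f x = x)}"

text \<open>Permutation topology = topology of pointwise convergence (product of discrete
topologies), restricted to Aut(T_5).\<close>
definition T5_top :: "(nat list \<Rightarrow> nat list) topology" where
  "T5_top = subtopology (product_topology (\<lambda>_. discrete_topology UNIV) UNIV) Aut_T5"

definition simple_graph :: "'v set \<Rightarrow> ('v \<Rightarrow> 'v \<Rightarrow> bool) \<Rightarrow> bool" where
  "simple_graph W E \<longleftrightarrow> (\<forall>u v. E u v \<longrightarrow> u \<in> W \<and> v \<in> W) \<and> (\<forall>u v. E u v \<longrightarrow> E v u) \<and> (\<forall>u. \<not> E u u)"

definition connected_graph :: "'v set \<Rightarrow> ('v \<Rightarrow> 'v \<Rightarrow> bool) \<Rightarrow> bool" where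
  "connected_graph W E \<longleftrightarrow> W \<noteq> {} \<and> (\<forall>u\<in>W. \<forall>v\<in>W. E\<^sup>*\<^sup>* u v)"

definition locally_finite_graph :: "'v set \<Rightarrow> ('v \<Rightarrow> 'v \<Rightarrow> bool) \<Rightarrow> bool" where
  "locally_finite_graph W E \<longleftrightarrow> (\<forall>v\<in>W. finite {u. E v u})"

definition degree :: "('v \<Rightarrow> 'v \<Rightarrow> bool) \<Rightarrow> 'v \<Rightarrow> nat" where
  "degree E v = card {u. E v u}"

definition cayley_abels_graph ::
  "('a \<Rightarrow> 'a) set \<Rightarrow> ('a \<Rightarrow> 'a) topology \<Rightarrow> 'v set \<Rightarrow> ('v \<Rightarrow> 'v \<Rightarrow> bool)
     \<Rightarrow> (('a \<Rightarrow> 'a) \<Rightarrow> 'v \<Rightarrow> 'v) \<Rightarrow> bool" where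
  "cayley_abels_graph G Tp W E act \<longleftrightarrow>
     simple_graph W E \<and> connected_graph W E \<and> locally_finite_graph W E \<and>
     (\<forall>g\<in>G. graph_aut W E (act g)) \<and>
     (\<forall>w\<in>W. act id w = w) \<and>
     (\<forall>g\<in>G. \<forall>h\<in>G. \<forall>w\<in>W. act (g \<circ> h) w = act g (act h w)) \<and>
     (\<forall>v\<in>W. \<forall>w\<in>W. \<exists>g\<in>G. act g v = w) \<and>
     (\<forall>v\<in>W. openin Tp {g\<in>G. act g v = v} \<and> compactin Tp {g\<in>G. act g v = v})"

end

theory Submission
  imports Defs "HOL-Combinatorics.Permutations"
begin

text \<open>
  Write \<open>G\<close> for the automorphism group of the tree. If \<open>G\<close> acts with compact open stabilizers and the
  stabilizer of \<open>x\<close> moves \<open>g x\<close> to at most three points, then some positive power of \<open>g\<close> fixes \<open>x\<close>: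
  otherwise \<open>g\<close> is a translation of the tree, and its scale, a power of 4, would be at most 3.
  On the other hand every open subgroup of \<open>G\<close> contains elements of order 3, whose action on the
  given graph is nontrivial.

  In a Cayley--Abels graph of degree at most 4 an element of order 3 then forces a suborbit of
  size 3 or 4 on the neighbours of a vertex. If all neighbours form one orbit, consider
  non-backtracking paths. In the remaining case the neighbours split as 3 + 1, the fixed
  neighbour defines an involution \<open>s\<close>, and one considers paths that alternate \<open>s\<close>-edges and other
  edges. Both kinds of path have at most three continuations at each step. If, for some \<open>n\<close>,
  elements of order 3 fixing a path of length \<open>n\<close> always fixed its continuations, such an element
  would fix the whole graph. So \<open>G\<close> is transitive on paths of every length; but a path
  \<open>x, g x, g\<^sup>2 x, \<dots>\<close> is periodic by the first paragraph, which contradicts transitivity.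
\<close>

section \<open>Reduced words\<close>

lemma T5_V_iff: "w \<in> T5_V \<longleftrightarrow> set w \<subseteq> {..<5} \<and> successively (\<noteq>) w"
  by (simp add: T5_V_def successively_conv_nth)

lemma Nil_in_T5_V [simp]: "[] \<in> T5_V"
  by (simp add: T5_V_iff)

lemma T5_V_appendD: "u @ w \<in> T5_V \<Longrightarrow> u \<in> T5_V" "u @ w \<in> T5_V \<Longrightarrow> w \<in> T5_V"
  by (auto simp: T5_V_iff successively_append_iff)

lemma T5_V_rev: "rev w \<in> T5_V \<longleftrightarrow> w \<in> T5_V"
proof -
  have "(\<lambda>x y :: nat. y \<noteq> x) = (\<noteq>)" by auto
  then show ?thesis by (simp only: T5_V_iff successively_rev set_rev)
qed

lemma T5_V_snoc:
  "w @ [a] \<in> T5_V \<longleftrightarrow> w \<in> T5_V \<and> a < 5 \<and> (w \<noteq> [] \<longrightarrow> last w \<noteq> a)"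
  by (auto simp: T5_V_iff successively_append_iff)

lemma T5_V_Cons:
  "a # w \<in> T5_V \<longleftrightarrow> w \<in> T5_V \<and> a < 5 \<and> (w \<noteq> [] \<longrightarrow> hd w \<noteq> a)"
  by (cases w) (auto simp: T5_V_iff)

lemma T5_adj_sym: "T5_adj u v \<Longrightarrow> T5_adj v u"
  by (auto simp: T5_adj_def)

lemma T5_adj_in: "T5_adj u v \<Longrightarrow> u \<in> T5_V \<and> v \<in> T5_V"
  by (auto simp: T5_adj_def)

lemma T5_adj_snoc: "w @ [a] \<in> T5_V \<Longrightarrow> T5_adj w (w @ [a])"
  by (auto simp: T5_adj_def dest: T5_V_appendD)

lemma T5_adj_cases:
  assumes "T5_adj u v"
  obtains a where "v = u @ [a]" "u @ [a] \<in> T5_V" | a where "u = v @ [a]" "v @ [a] \<in> T5_V"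
  using assms by (auto simp: T5_adj_def)

section \<open>The automorphism group\<close>

lemma Aut_T5_bij: "g \<in> Aut_T5 \<Longrightarrow> bij g"
proof -
  assume g: "g \<in> Aut_T5"
  have "bij_betw g T5_V T5_V" "bij_betw g (- T5_V) (- T5_V)"
    using g by (auto simp: Aut_T5_def graph_aut_def bij_betw_def inj_on_def)
  then have "bij_betw g (T5_V \<union> - T5_V) (T5_V \<union> - T5_V)"
    by (rule bij_betw_combine) auto
  then show ?thesis by simp
qed

lemma Aut_T5_in: "g \<in> Aut_T5 \<Longrightarrow> g w \<in> T5_V \<longleftrightarrow> w \<in> T5_V"
  by (cases "w \<in> T5_V") (auto simp: Aut_T5_def graph_aut_def bij_betw_def)

lemma Aut_T5_adj: "g \<in> Aut_T5 \<Longrightarrow> T5_adj (g u) (g v) \<longleftrightarrow> T5_adj u v"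
proof -
  assume g: "g \<in> Aut_T5"
  have "T5_adj u v \<longleftrightarrow> T5_adj (g u) (g v)" if "u \<in> T5_V" "v \<in> T5_V"
    using g that unfolding Aut_T5_def graph_aut_def by blast
  then show ?thesis using T5_adj_in Aut_T5_in[OF g] by metis
qed

lemma Aut_T5_outside: "g \<in> Aut_T5 \<Longrightarrow> w \<notin> T5_V \<Longrightarrow> g w = w"
  by (auto simp: Aut_T5_def)

text \<open>Adjacency is symmetric, so \<open>f\<close> and its inverse \<open>h\<close> need
  testing only on edges from a word to a one-letter extension.\<close>

lemma Aut_T5_I:
  assumes "\<And>w. w \<in> T5_V \<Longrightarrow> f w \<in> T5_V" "\<And>w. w \<in> T5_V \<Longrightarrow> h w \<in> T5_V"
    and "\<And>w. w \<in> T5_V \<Longrightarrow> h (f w) = w" "\<And>w. w \<in> T5_V \<Longrightarrow> f (h w) = w"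
    and "\<And>w a. w @ [a] \<in> T5_V \<Longrightarrow> T5_adj (f w) (f (w @ [a]))"
    and "\<And>w a. w @ [a] \<in> T5_V \<Longrightarrow> T5_adj (h w) (h (w @ [a]))"
    and "\<And>w. w \<notin> T5_V \<Longrightarrow> f w = w"
  shows "f \<in> Aut_T5"
proof -
  have f: "T5_adj (f u) (f v)" if "T5_adj u v" for u v
    using that by (rule T5_adj_cases) (use assms(5) T5_adj_sym in blast)+
  have h: "T5_adj (h u) (h v)" if "T5_adj u v" for u v
    using that by (rule T5_adj_cases) (use assms(6) T5_adj_sym in blast)+
  have "bij_betw f T5_V T5_V"
    by (rule bij_betw_byWitness[where f' = h]) (use assms in auto)
  moreover have "T5_adj u v \<longleftrightarrow> T5_adj (f u) (f v)" if "u \<in> T5_V" "v \<in> T5_V" for u v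
    using f h[of "f u" "f v"] assms(3) that by auto
  ultimately show ?thesis
    using assms(7) by (auto simp: Aut_T5_def graph_aut_def)
qed

lemma Aut_T5_id [simp]: "id \<in> Aut_T5"
  by (auto simp: Aut_T5_def graph_aut_def)

lemma Aut_T5_comp [intro]: "f \<in> Aut_T5 \<Longrightarrow> g \<in> Aut_T5 \<Longrightarrow> f \<circ> g \<in> Aut_T5"
proof -
  assume f: "f \<in> Aut_T5" and g: "g \<in> Aut_T5"
  have "bij_betw (f \<circ> g) T5_V T5_V"
    using f g by (auto simp: Aut_T5_def graph_aut_def intro: bij_betw_trans)
  then show ?thesis
    using Aut_T5_adj[OF f] Aut_T5_adj[OF g] Aut_T5_outside[OF f] Aut_T5_outside[OF g]
    by (simp add: Aut_T5_def graph_aut_def)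
qed

lemma Aut_T5_inv [intro]:
  assumes "f \<in> Aut_T5" shows "inv f \<in> Aut_T5"
proof -
  have b: "bij f" using assms by (rule Aut_T5_bij)
  have fi: "f (inv f w) = w" for w using b by (simp add: bij_is_surj surj_f_inv_f)
  have "inv f w \<in> T5_V \<longleftrightarrow> w \<in> T5_V" for w
    using Aut_T5_in[OF assms, of "inv f w"] by (simp add: fi)
  moreover have "T5_adj (inv f u) (inv f v) \<longleftrightarrow> T5_adj u v" for u v
    using Aut_T5_adj[OF assms, of "inv f u" "inv f v"] by (simp add: fi)
  moreover have "inv f w = w" if "w \<notin> T5_V" for w
    using that assms b by (metis Aut_T5_outside bij_inv_eq_iff)
  ultimately show ?thesis
    using b by (intro Aut_T5_I[where h = f])
      (simp_all add: Aut_T5_in[OF assms] Aut_T5_adj[OF assms] bij_is_inj fi T5_adj_snoc)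
qed

lemma Aut_T5_funpow: "g \<in> Aut_T5 \<Longrightarrow> g ^^ n \<in> Aut_T5"
  by (induction n) auto

lemma Aut_T5_inv_apply [simp]:
  assumes "g \<in> Aut_T5" shows "inv g (g w) = w" "g (inv g w) = w"
  using Aut_T5_bij[OF assms] by (auto simp: bij_is_inj bij_is_surj surj_f_inv_f)

lemma Aut_T5_inv_comp [simp]:
  assumes "g \<in> Aut_T5" shows "inv g \<circ> g = id" "g \<circ> inv g = id"
  using assms by (auto simp: fun_eq_iff)

text \<open>Left multiplication by a generator of the free product of five copies of Z/2.\<close>

definition lmul :: "nat \<Rightarrow> nat list \<Rightarrow> nat list" where
  "lmul a w = (if w \<notin> T5_V then w else if w \<noteq> [] \<and> hd w = a then tl w else a # w)"

lemma lmul_in: "a < 5 \<Longrightarrow> w \<in> T5_V \<Longrightarrow> lmul a w \<in> T5_V"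
  by (cases w) (auto simp: lmul_def T5_V_Cons)

lemma lmul_lmul: "a < 5 \<Longrightarrow> w \<in> T5_V \<Longrightarrow> lmul a (lmul a w) = w"
  by (cases w; cases "tl w") (auto simp: lmul_def T5_V_Cons)

lemma lmul_Aut: "a < 5 \<Longrightarrow> lmul a \<in> Aut_T5"
proof (rule Aut_T5_I[where h = "lmul a"])
  fix w b assume a: "a < 5" and w: "w @ [b] \<in> T5_V"
  have wV: "w \<in> T5_V" using w by (rule T5_V_appendD)
  show "T5_adj (lmul a w) (lmul a (w @ [b]))" "T5_adj (lmul a w) (lmul a (w @ [b]))"
    using lmul_in[OF a wV] lmul_in[OF a w] w wV
    by (cases w; auto simp: T5_adj_def lmul_def)+
qed (auto simp: lmul_in lmul_lmul, simp add: lmul_def)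

text \<open>The action of the group element represented by \<open>u\<close>; as the generators are
  involutions, \<open>rev u\<close> represents its inverse.\<close>

definition lmulw :: "nat list \<Rightarrow> nat list \<Rightarrow> nat list" where
  "lmulw u = foldr (\<lambda>a f. lmul a \<circ> f) u id"

lemma lmulw_simps [simp]: "lmulw [] = id" "lmulw (a # u) = lmul a \<circ> lmulw u"
  by (simp_all add: lmulw_def)

lemma lmulw_Aut: "set u \<subseteq> {..<5} \<Longrightarrow> lmulw u \<in> Aut_T5"
  by (induction u) (auto intro: lmul_Aut)

lemma lmulw_append: "lmulw (u @ w) = lmulw u \<circ> lmulw w"
  by (induction u) auto

lemma lmulw_eq: "u @ w \<in> T5_V \<Longrightarrow> lmulw u w = u @ w"
  by (induction u) (auto simp: T5_V_Cons lmul_def)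

lemma lmulw_rev: "u @ w \<in> T5_V \<Longrightarrow> lmulw (rev u) (u @ w) = w"
  by (induction u) (auto simp: T5_V_Cons lmulw_append lmul_def)

lemma T5_V_set: "w \<in> T5_V \<Longrightarrow> set w \<subseteq> {..<5}"
  by (simp add: T5_V_iff)

lemma Aut_T5_from_Nil: "w \<in> T5_V \<Longrightarrow> \<exists>g\<in>Aut_T5. g [] = w"
  by (rule bexI[of _ "lmulw w"]) (use lmulw_eq[of w "[]"] lmulw_Aut T5_V_set in auto)

lemma Aut_T5_transitive:
  assumes "v \<in> T5_V" "w \<in> T5_V" shows "\<exists>g\<in>Aut_T5. g v = w"
proof -
  obtain f g where "f \<in> Aut_T5" "f [] = v" "g \<in> Aut_T5" "g [] = w"
    using Aut_T5_from_Nil assms by metis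
  moreover from this have "inv f v = []" by (metis Aut_T5_inv_apply(1))
  ultimately show ?thesis by (intro bexI[of _ "g \<circ> inv f"]) auto
qed

section \<open>Automorphisms supported on a single branch of the tree\<close>

definition branch_perm :: "nat list \<Rightarrow> (nat \<Rightarrow> nat) \<Rightarrow> nat list \<Rightarrow> nat list" where
  "branch_perm b \<pi> w =
    (if w \<in> T5_V \<and> take (length b) w = b then b @ map \<pi> (drop (length b) w) else w)"

lemma branch_perm_append: "b @ u \<in> T5_V \<Longrightarrow> branch_perm b \<pi> (b @ u) = b @ map \<pi> u"
  by (simp add: branch_perm_def)

lemma branch_perm_other: "take (length b) w \<noteq> b \<Longrightarrow> branch_perm b \<pi> w = w"
  by (simp add: branch_perm_def)

lemma branch_perm_in:
  assumes "\<pi> permutes {..<5}" "b \<noteq> [] \<Longrightarrow> \<pi> (last b) = last b" "b @ u \<in> T5_V"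
  shows "b @ map \<pi> u \<in> T5_V"
proof -
  have i: "\<pi> x = \<pi> y \<longleftrightarrow> x = y" for x y
    using permutes_inj[OF assms(1)] by (auto dest: injD)
  have "set (map \<pi> u) \<subseteq> {..<5}"
    using assms(3) permutes_in_image[OF assms(1)] by (auto simp: T5_V_iff)
  moreover have "last b \<noteq> hd (map \<pi> u)" if "b \<noteq> []" "u \<noteq> []"
  proof -
    have "last b \<noteq> hd u" using assms(3) that by (simp add: T5_V_iff successively_append_iff)
    then have "\<pi> (last b) \<noteq> \<pi> (hd u)" by (simp add: i)
    then show ?thesis using assms(2) that by (simp add: hd_map)
  qed
  ultimately show ?thesis using assms(3) 
    by (auto simp: T5_V_iff successively_append_iff successively_map i)
qed

text \<open>Since \<open>\<pi>\<close> fixes the last letter of \<open>b\<close>, relabelling the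
  letters after \<open>b\<close> creates no repetition at the seam; relabelling by
  \<open>inv \<pi>\<close> is the inverse.\<close>

lemma branch_perm_Aut:
  assumes p: "\<pi> permutes {..<5}" and l: "b \<noteq> [] \<Longrightarrow> \<pi> (last b) = last b"
  shows "branch_perm b \<pi> \<in> Aut_T5"
proof -
  have ip: "inv \<pi> permutes {..<5}" using p by (rule permutes_inv)
  have il: "inv \<pi> (last b) = last b" if "b \<noteq> []" using l that p by (metis permutes_inverses(2))
  have in_V: "branch_perm b \<rho> w \<in> T5_V"
    if "\<rho> permutes {..<5}" "b \<noteq> [] \<Longrightarrow> \<rho> (last b) = last b" "w \<in> T5_V" for \<rho> w
  proof (cases "take (length b) w = b")
    case True
    then have "b @ drop (length b) w \<in> T5_V" using that(3) by (metis append_take_drop_id)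
    then show ?thesis using branch_perm_in[OF that(1,2)] True that(3) by (simp add: branch_perm_def)
  qed (use that in \<open>simp add: branch_perm_def\<close>)
  have adj: "T5_adj (branch_perm b \<rho> w) (branch_perm b \<rho> (w @ [a]))"
    if \<rho>: "\<rho> permutes {..<5}" "b \<noteq> [] \<Longrightarrow> \<rho> (last b) = last b" and w: "w @ [a] \<in> T5_V" for \<rho> w a
  proof -
    have "w \<in> T5_V" using w by (rule T5_V_appendD)
    \<comment> \<open>An edge lies inside the branch at \<open>b\<close>, joins \<open>b\<close> to
      its parent, or lies outside the branch.\<close>
    consider "take (length b) w = b" | "w @ [a] = b" | "take (length b) (w @ [a]) \<noteq> b" "take (length b) w \<noteq> b"
      by (cases "length b \<le> length w") (auto split: if_splits)
    then show ?thesis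
    proof cases
      case 1
      then have "length b \<le> length w" by (metis nat_le_linear take_all)
      then show ?thesis using in_V[OF \<rho> w] in_V[OF \<rho> \<open>w \<in> T5_V\<close>] 1 w \<open>w \<in> T5_V\<close>
        by (simp add: branch_perm_def T5_adj_def)
    next
      case 2
      then have "take (length b) w \<noteq> b" by auto
      then show ?thesis using 2 w T5_adj_snoc[OF w] by (auto simp: branch_perm_def)
    next
      case 3
      then show ?thesis using T5_adj_snoc[OF w] by (simp add: branch_perm_other)
    qed
  qed
  have canc: "branch_perm b \<rho> (branch_perm b \<sigma> w) = w"
    if "\<sigma> permutes {..<5}" "b \<noteq> [] \<Longrightarrow> \<sigma> (last b) = last b" "w \<in> T5_V" "\<rho> \<circ> \<sigma> = id" for \<rho> \<sigma> w
  proof (cases "take (length b) w = b")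
    case True
    define u where "u = drop (length b) w"
    have w: "w = b @ u" using True by (metis append_take_drop_id u_def)
    show ?thesis using that branch_perm_in[OF that(1,2), of u] 
      by (simp add: w branch_perm_append)
  qed (simp add: branch_perm_other)
  show ?thesis
  proof (rule Aut_T5_I[where h = "branch_perm b (inv \<pi>)"])
    show "branch_perm b (inv \<pi>) (branch_perm b \<pi> w) = w" if "w \<in> T5_V" for w
      using canc[OF p l that] permutes_inv_o[OF p] by simp
    show "branch_perm b \<pi> (branch_perm b (inv \<pi>) w) = w" if "w \<in> T5_V" for w
      using canc[OF ip il that] permutes_inv_o[OF p] by simp
    show "branch_perm b \<pi> w = w" if "w \<notin> T5_V" for w
      using that by (simp add: branch_perm_def)
  qed (use in_V[OF p l] in_V[OF ip il] adj[OF p l] adj[OF ip il] in simp_all)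
qed

section \<open>Distances\<close>

definition T5_dist :: "nat list \<Rightarrow> nat list \<Rightarrow> nat" where
  "T5_dist x y = (LEAST n. (T5_adj ^^ n) x y)"

lemma relpowp_Aut:
  assumes g: "g \<in> Aut_T5" shows "(T5_adj ^^ n) (g x) (g y) \<longleftrightarrow> (T5_adj ^^ n) x y"
proof -
  have *: "(T5_adj ^^ n) (f x) (f y)" if "(T5_adj ^^ n) x y" "f \<in> Aut_T5" for f x y
    using that(1)
  proof (induction n arbitrary: y)
    case (Suc n)
    then show ?case using Aut_T5_adj[OF that(2)] by (metis relpowp_Suc_E relpowp_Suc_I)
  qed auto
  show ?thesis using *[OF _ g, of x y] *[OF _ Aut_T5_inv[OF g], of "g x" "g y"] g by auto
qed

lemma T5_dist_Aut: "g \<in> Aut_T5 \<Longrightarrow> T5_dist (g x) (g y) = T5_dist x y"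
  by (simp add: T5_dist_def relpowp_Aut)

text \<open>Each step changes the length of a word by one, and appending the letters of
  \<open>w\<close> in turn attains the bound.\<close>

lemma T5_dist_Nil:
  assumes "w \<in> T5_V" shows "T5_dist [] w = length w"
  unfolding T5_dist_def
proof (rule Least_equality)
  show "(T5_adj ^^ length w) [] w"
    using assms by (induction w rule: rev_induct) (auto dest: T5_V_appendD T5_adj_snoc)
  show "length w \<le> n" if "(T5_adj ^^ n) [] w" for n
    using that
  proof (induction n arbitrary: w)
    case (Suc n)
    then obtain u where "(T5_adj ^^ n) [] u" "T5_adj u w" by auto
    with Suc.IH[of u] show ?case by (auto elim!: T5_adj_cases)
  qed auto
qed

lemma T5_adj_rtranclp: "u \<in> T5_V \<Longrightarrow> w \<in> T5_V \<Longrightarrow> T5_adj\<^sup>*\<^sup>* u w"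
proof -
  have *: "T5_adj\<^sup>*\<^sup>* [] w \<and> T5_adj\<^sup>*\<^sup>* w []" if "w \<in> T5_V" for w
    using that
  proof (induction w rule: rev_induct)
    case (snoc a w)
    then have "T5_adj w (w @ [a])" "T5_adj (w @ [a]) w" "w \<in> T5_V"
      using T5_adj_snoc T5_adj_sym T5_V_appendD by blast+
    with snoc.IH show ?case
      by (meson converse_rtranclp_into_rtranclp rtranclp.rtrancl_into_rtrancl)
  qed auto
  assume "u \<in> T5_V" "w \<in> T5_V"
  then show ?thesis using * by (meson rtranclp_trans)
qed

lemma T5_dist_commute: "T5_dist x y = T5_dist y x"
proof -
  have *: "(T5_adj ^^ n) y x" if "(T5_adj ^^ n) x y" for n x y
    using that
  proof (induction n arbitrary: y)
    case (Suc n)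
    then show ?case by (metis relpowp_Suc_E relpowp_Suc_I2 T5_adj_sym)
  qed auto
  show ?thesis unfolding T5_dist_def by (rule arg_cong[where f = Least]) (auto intro: *)
qed

lemma T5_dist_lmulw:
  assumes "b @ x \<in> T5_V" "b @ y \<in> T5_V" shows "T5_dist (b @ x) (b @ y) = T5_dist x y"
  using T5_dist_Aut[of "lmulw b" x y] assms
  by (simp add: lmulw_eq lmulw_Aut T5_V_set T5_V_appendD(1))

text \<open>In the free product, \<open>lmulw (rev x)\<close> is left multiplication by the inverse
  of \<open>x\<close>. It moves \<open>x\<close> to the root and \<open>y\<close> to
  \<open>rev x @ y\<close>, where nothing cancels because the first letters differ.\<close>

lemma T5_dist_diverge:
  assumes "x \<in> T5_V" "y \<in> T5_V" "x \<noteq> []" "y \<noteq> []" "hd x \<noteq> hd y"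
  shows "T5_dist x y = length x + length y"
proof -
  have V: "rev x @ y \<in> T5_V"
    using assms T5_V_rev[of x] by (auto simp: T5_V_iff successively_append_iff last_rev simp del: successively_rev)
  have "T5_dist x y = T5_dist (lmulw (rev x) x) (lmulw (rev x) y)"
    using assms(1) T5_dist_Aut[of "lmulw (rev x)"] lmulw_Aut[of "rev x"] by (simp add: T5_V_iff)
  also have "\<dots> = T5_dist [] (rev x @ y)"
    using lmulw_rev[of x "[]"] lmulw_eq[OF V] assms(1) by simp
  also have "\<dots> = length x + length y" using T5_dist_Nil[OF V] by simp
  finally show ?thesis .
qed

section \<open>Spheres and orbits of vertex stabilizers\<close>

lemma finite_T5_sphere_Nil: "finite {w \<in> T5_V. length w = n}"
  by (rule finite_subset[OF _ finite_lists_length_eq[of "{..<5::nat}" n]]) (auto simp: T5_V_iff)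

lemma finite_T5_sphere:
  assumes "p \<in> T5_V" shows "finite {w \<in> T5_V. T5_dist p w = n}"
proof -
  obtain f where f: "f \<in> Aut_T5" "f [] = p" using assms Aut_T5_from_Nil by blast
  have "{w \<in> T5_V. T5_dist p w = n} \<subseteq> f ` {w \<in> T5_V. length w = n}"
  proof
    fix w assume w: "w \<in> {w \<in> T5_V. T5_dist p w = n}"
    have "inv f w \<in> T5_V" using w f by (auto simp: Aut_T5_in Aut_T5_inv)
    moreover have "T5_dist [] (inv f w) = n"
      using w f T5_dist_Aut[OF f(1), of "[]" "inv f w"] by simp
    ultimately show "w \<in> f ` {w \<in> T5_V. length w = n}"
      using f T5_dist_Nil by (intro image_eqI[of _ _ "inv f w"]) auto
  qed
  then show ?thesis using finite_T5_sphere_Nil finite_surj by blast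
qed

lemma card_T5_sphere_Nil: "4 ^ n \<le> card {w \<in> T5_V. length w = n}"
proof (induction n)
  case 0
  have "{w \<in> T5_V. length w = 0} = {[]}" by auto
  then show ?case by simp
next
  case (Suc n)
  let ?S = "\<lambda>n. {w \<in> T5_V. length w = n}"
  \<comment> \<open>Only four of the five letters are used after the empty word, so that every word
    gets exactly four chosen extensions.\<close>
  let ?L = "\<lambda>w :: nat list. if w = [] then {..<4} else {..<5::nat} - {last w}"
  have fin: "finite (?L w)" for w by simp
  have c: "card (?L w) = 4" if "w \<in> ?S n" for w
  proof (cases "w = []")
    case False
    then have "last w \<in> {..<5}" using that last_in_set by (fastforce simp: T5_V_iff)
    then show ?thesis using False by simp
  qed simp
  have "4 * 4 ^ n \<le> 4 * card (?S n)" using Suc by simp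
  also have "\<dots> = (\<Sum>w\<in>?S n. card (?L w))" using c by simp
  also have "\<dots> = card (Sigma (?S n) ?L)"
    by (rule card_SigmaI[symmetric]) (use finite_T5_sphere_Nil fin in auto)
  also have "\<dots> \<le> card (?S (Suc n))"
  proof (rule card_inj_on_le[where f = "\<lambda>(w, a). w @ [a]"])
    show "inj_on (\<lambda>(w, a). w @ [a]) (Sigma (?S n) ?L)" by (auto simp: inj_on_def)
    show "(\<lambda>(w, a). w @ [a]) ` Sigma (?S n) ?L \<subseteq> ?S (Suc n)"
      by (auto simp: T5_V_snoc split: if_splits)
    show "finite (?S (Suc n))" by (rule finite_T5_sphere_Nil)
  qed
  finally show ?case by simp
qed

text \<open>The image of \<open>x\<close> is corrected letter by letter. Once a prefix
  \<open>b\<close> agrees with \<open>y\<close>, the two next letters both differ from the last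
  letter of \<open>b\<close>, so swapping them on the branch at \<open>b\<close> is an automorphism
  that keeps \<open>b\<close>.\<close>

lemma Aut_T5_sphere_transitive:
  assumes "x \<in> T5_V" "y \<in> T5_V" "length x = length y"
  shows "\<exists>g\<in>Aut_T5. g [] = [] \<and> g x = y"
proof -
  have "\<exists>g\<in>Aut_T5. g [] = [] \<and> take k (g x) = take k y" for k
  proof (induction k)
    case 0
    then show ?case by (intro bexI[of _ id]) auto
  next
    case (Suc k)
    then obtain g where g: "g \<in> Aut_T5" "g [] = []" "take k (g x) = take k y" by blast
    have gx: "g x \<in> T5_V" using g assms by (simp add: Aut_T5_in)
    have len: "length (g x) = length y"
      using T5_dist_Aut[OF g(1), of "[]" x] g(2) gx assms T5_dist_Nil by simp
    show ?case
    proof (cases "k < length y")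
      case False
      then show ?thesis using g len by (intro bexI[of _ g]) auto
    next
      case True
      define b where "b = take k y"
      define a where "a = g x ! k"
      define c where "c = y ! k"
      obtain u where u: "g x = b @ a # u"
        using True len g(3) by (metis a_def b_def id_take_nth_drop)
      obtain v where v: "y = b @ c # v"
        using True by (metis b_def c_def id_take_nth_drop)
      have kb: "length b = k" using True by (simp add: b_def)
      have ac: "a < 5" "c < 5" "b \<noteq> [] \<Longrightarrow> last b \<noteq> a" "b \<noteq> [] \<Longrightarrow> last b \<noteq> c"
        using gx assms(2) unfolding u v by (auto simp: T5_V_iff successively_append_iff)
      define h where "h = branch_perm b (Transposition.transpose a c)"
      have h: "h \<in> Aut_T5" unfolding h_def
        by (rule branch_perm_Aut) (use ac in \<open>auto intro!: permutes_swap_id simp: Transposition.transpose_def\<close>)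
      have "h (g x) = b @ c # map (Transposition.transpose a c) u"
        unfolding h_def u by (subst branch_perm_append) (use gx u in \<open>auto simp: Transposition.transpose_def\<close>)
      moreover have "h [] = []" by (cases b) (auto simp: h_def branch_perm_def)
      ultimately show ?thesis
        using g h kb v by (intro bexI[of _ "h \<circ> g"]) auto
    qed
  qed
  from this[of "length y"] obtain g where g: "g \<in> Aut_T5" "g [] = []" "take (length y) (g x) = y"
    by auto
  have "length (g x) = length y"
    using T5_dist_Aut[OF g(1), of "[]" x] g(1,2) assms T5_dist_Nil by (simp add: Aut_T5_in)
  then show ?thesis using g by auto
qed

text \<open>After transport of \<open>p\<close> to the root, the orbit contains a whole
  sphere.\<close>

lemma card_stabilizer_orbit:
  assumes p: "p \<in> T5_V" and w: "w \<in> T5_V"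
  shows "4 ^ T5_dist p w \<le> card {g w |g. g \<in> Aut_T5 \<and> g p = p}" (is "_ \<le> card ?O")
proof -
  obtain f where f: "f \<in> Aut_T5" "f [] = p" using p Aut_T5_from_Nil by blast
  define u where "u = inv f w"
  have u: "u \<in> T5_V" "w = f u" using f w by (auto simp: u_def Aut_T5_in Aut_T5_inv)
  have lu: "length u = T5_dist p w"
    using T5_dist_Aut[OF f(1), of "[]" u] f(2) u T5_dist_Nil by simp
  have "4 ^ T5_dist p w \<le> card {v \<in> T5_V. length v = T5_dist p w}" by (rule card_T5_sphere_Nil)
  also have "\<dots> \<le> card ?O"
  proof (rule card_inj_on_le[where f = f])
    show "inj_on f {v \<in> T5_V. length v = T5_dist p w}"
      using Aut_T5_bij[OF f(1)] by (meson bij_is_inj inj_on_subset subset_UNIV)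
    show "f ` {v \<in> T5_V. length v = T5_dist p w} \<subseteq> ?O"
    proof
      fix z assume "z \<in> f ` {v \<in> T5_V. length v = T5_dist p w}"
      then obtain v where v: "v \<in> T5_V" "length v = length u" "z = f v" using lu by auto
      then obtain g where g: "g \<in> Aut_T5" "g [] = []" "g u = v"
        using Aut_T5_sphere_transitive u by metis
      have "(f \<circ> g \<circ> inv f) p = p" using f g by (metis Aut_T5_inv_apply(1) comp_apply)
      moreover have "(f \<circ> g \<circ> inv f) w = z" using f g u v by simp
      ultimately show "z \<in> ?O" using f g by (intro CollectI exI[of _ "f \<circ> g \<circ> inv f"]) auto
    qed
    have "?O \<subseteq> {v \<in> T5_V. T5_dist p v = T5_dist p w}"
      using w T5_dist_Aut Aut_T5_in by (smt (verit) mem_Collect_eq subsetI)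
    then show "finite ?O" using finite_T5_sphere[OF p] finite_subset by blast
  qed
  finally show ?thesis .
qed

text \<open>A root of minimal displacement lies on the axis of \<open>g\<close>: its preimage
  \<open>z\<close> and its image \<open>u\<close> leave it in different directions, so the geodesic
  from \<open>z\<close> to the root continues to \<open>u\<close>, and the translates concatenate.
  The assumption \<open>moves\<close> excludes a fixed root and a root swapped with its
  image.\<close>

lemma Aut_T5_translation_Nil:
  assumes g: "g \<in> Aut_T5"
    and min: "\<And>x. x \<in> T5_V \<Longrightarrow> T5_dist [] (g []) \<le> T5_dist x (g x)"
    and moves: "g [] \<noteq> []" "g (g []) \<noteq> []"
  shows "T5_dist [] ((g ^^ n) []) = n * T5_dist [] (g [])"
proof -
  define u where "u = g []"
  define z where "z = inv g []"
  have V: "u \<in> T5_V" "z \<in> T5_V" using g by (auto simp: u_def z_def Aut_T5_in Aut_T5_inv)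
  have gz: "g z = []" using g by (simp add: z_def)
  have lz: "length z = length u"
  proof -
    have "T5_dist z [] = T5_dist [] u" using T5_dist_Aut[OF g, of z "[]"] gz by (simp add: u_def)
    then show ?thesis using V T5_dist_Nil T5_dist_commute by metis
  qed
  have ne: "u \<noteq> []" "z \<noteq> []" using moves lz by (auto simp: u_def)
  \<comment> \<open>If both began with \<open>a\<close>, then \<open>g [a]\<close> would be the
    neighbour of \<open>u\<close> towards the root. Then either \<open>g\<close> swaps
    \<open>[]\<close> and \<open>[a]\<close>, or the displacement of \<open>[a]\<close> is smaller
    by 2.\<close>
  have diverge: "hd u \<noteq> hd z"
  proof
    assume eq: "hd u = hd z"
    obtain a u' where u: "u = a # u'" using ne by (cases u) auto
    obtain z' where z: "z = a # z'" using ne eq u by (cases z) auto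
    have aV: "[a] \<in> T5_V" using V u T5_V_appendD(1)[of "[a]" u'] by simp
    have gaV: "g [a] \<in> T5_V" using g aV by (simp add: Aut_T5_in)
    have "T5_dist (g [a]) [] = T5_dist [a] z" using T5_dist_Aut[OF g, of "[a]" z] gz by simp
    also have "\<dots> = T5_dist [] z'" using T5_dist_lmulw[of "[a]" "[]" z'] V z aV by simp
    also have "\<dots> = length u'" using V(2) z lz u T5_dist_Nil[of z'] by (simp add: T5_V_Cons)
    finally have len: "length (g [a]) = length u'"
      using T5_dist_Nil[OF gaV] T5_dist_commute by metis
    have "T5_adj u (g [a])"
      using Aut_T5_adj[OF g, of "[]" "[a]"] T5_adj_snoc[of "[]" a] aV by (simp add: u_def)
    then have ga: "g [a] = butlast u"
    proof (rule T5_adj_cases)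
      show "g [a] = butlast u" if "g [a] = u @ [c]" for c using that len u by simp
      show "g [a] = butlast u" if "u = g [a] @ [c]" for c using that by (metis butlast_snoc)
    qed
    show False
    proof (cases u')
      case Nil
      then show False using moves ga u by (simp add: u_def)
    next
      case (Cons c cs)
      have V': "butlast u = [a] @ butlast u'" using Cons u by simp
      then have "butlast u' \<in> T5_V" using gaV ga T5_V_appendD(2) by metis
      then have "T5_dist [a] (g [a]) = length (butlast u')"
        using T5_dist_lmulw[of "[a]" "[]" "butlast u'"] T5_dist_Nil gaV ga V' aV by simp
      moreover have "T5_dist [] (g []) = length u" using T5_dist_Nil[OF V(1)] by (simp add: u_def)
      ultimately show False using min[OF aV] u by simp
    qed
  qed
  \<comment> \<open>The first letter is carried through the induction: it keeps \<open>w\<close> and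
    \<open>z\<close> in different branches at the root, so that their lengths add up.\<close>
  have "length ((g ^^ n) []) = n * length u \<and> (n > 0 \<longrightarrow> hd ((g ^^ n) []) = hd u)" for n
  proof (induction n)
    case (Suc n)
    define w where "w = (g ^^ n) []"
    have w: "w \<in> T5_V" "g w \<in> T5_V" using Aut_T5_in[OF Aut_T5_funpow[OF g]] g by (auto simp: w_def Aut_T5_in)
    have IH: "length w = n * length u" "n > 0 \<longrightarrow> hd w = hd u" using Suc by (auto simp: w_def)
    have "T5_dist [] (g w) = T5_dist z w" using T5_dist_Aut[OF g, of z w] gz by simp
    also have "\<dots> = length z + length w"
    proof (cases "n = 0")
      case True
      then show ?thesis using IH V T5_dist_Nil T5_dist_commute by (metis add.right_neutral length_0_conv mult_0)
    next
      case False
      moreover have "w \<noteq> []" using IH(1) False ne by auto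
      ultimately show ?thesis using IH diverge V w ne by (intro T5_dist_diverge) auto
    qed
    finally have len: "length (g w) = Suc n * length u" using T5_dist_Nil[OF w(2)] IH lz by simp
    \<comment> \<open>Otherwise the geodesic from \<open>u\<close> to \<open>g w\<close> would pass
      through the root and be longer than its preimage, the geodesic from \<open>[]\<close> to
      \<open>w\<close>.\<close>
    have "hd (g w) = hd u"
    proof (rule ccontr)
      assume "hd (g w) \<noteq> hd u"
      moreover have "g w \<noteq> []" using len ne by auto
      ultimately have "T5_dist u (g w) = length u + length (g w)"
        using T5_dist_diverge[of u "g w"] V w ne by auto
      moreover have "T5_dist u (g w) = length w"
        using T5_dist_Aut[OF g, of "[]" w] T5_dist_Nil[OF w(1)] by (simp add: u_def)
      ultimately show False using len IH ne by simp
    qed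
    then show ?case using len by (simp add: w_def)
  qed simp
  moreover have "(g ^^ n) [] \<in> T5_V" using Aut_T5_in[OF Aut_T5_funpow[OF g]] by simp
  ultimately show ?thesis using T5_dist_Nil V by (simp add: u_def)
qed

lemma conj_funpow:
  assumes "f \<in> Aut_T5" shows "(inv f \<circ> g \<circ> f) ^^ n = inv f \<circ> (g ^^ n) \<circ> f"
  by (induction n) (use assms in \<open>auto simp: fun_eq_iff\<close>)

text \<open>A vertex of minimal displacement is conjugated to the root. If it is fixed, or swapped
  with its image, the period is 1 or 2; otherwise \<open>g\<close> translates by at least 1.\<close>

lemma Aut_T5_elliptic_or_translation:
  assumes g: "g \<in> Aut_T5"
  obtains p m where "p \<in> T5_V" "m > 0" "(g ^^ m) p = p"
  | p where "p \<in> T5_V" "\<And>n. n \<le> T5_dist p ((g ^^ n) p)"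
proof -
  obtain p where p: "p \<in> T5_V" "\<And>x. x \<in> T5_V \<Longrightarrow> T5_dist p (g p) \<le> T5_dist x (g x)"
    using ex_has_least_nat[of "\<lambda>x. x \<in> T5_V" "[]" "\<lambda>x. T5_dist x (g x)"] by auto
  obtain f where f: "f \<in> Aut_T5" "f [] = p" using p Aut_T5_from_Nil by blast
  define h where "h = inv f \<circ> g \<circ> f"
  have h: "h \<in> Aut_T5" using f g by (auto simp: h_def)
  have hn: "(h ^^ n) [] = inv f ((g ^^ n) p)" for n using f by (simp add: h_def conj_funpow)
  have d: "T5_dist x (h x) = T5_dist (f x) (g (f x))" for x
    using T5_dist_Aut[OF f(1), of x "h x"] f by (simp add: h_def)
  have periodic: "(g ^^ m) p = p" if "(h ^^ m) [] = []" for m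
    using that f hn[of m] by (metis Aut_T5_inv_apply(2))
  consider "h [] = []" | "h (h []) = []" | "h [] \<noteq> []" "h (h []) \<noteq> []" by blast
  then show thesis
  proof cases
    case 1
    then show thesis using that(1)[of p 1] p periodic[of 1] by simp
  next
    case 2
    then show thesis using that(1)[of p 2] p periodic[of 2] by (simp add: numeral_2_eq_2)
  next
    case 3
    have "T5_dist [] (h []) \<le> T5_dist x (h x)" if "x \<in> T5_V" for x
      using p(2)[of "f x"] that f by (simp add: d Aut_T5_in)
    from Aut_T5_translation_Nil[OF h this 3]
    have *: "T5_dist [] ((h ^^ n) []) = n * T5_dist [] (h [])" for n .
    have "h [] \<in> T5_V" using h by (simp add: Aut_T5_in)
    then have "T5_dist [] (h []) > 0" using T5_dist_Nil 3 by simp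
    then have "n \<le> T5_dist p ((g ^^ n) p)" for n
      using *[of n] T5_dist_Aut[OF f(1), of "[]" "(h ^^ n) []"] f by (simp add: hn)
    then show thesis using that(2) p by blast
  qed
qed

section \<open>The permutation topology\<close>

abbreviation pointwise_top :: "(nat list \<Rightarrow> nat list) topology" where
  "pointwise_top \<equiv> product_topology (\<lambda>_. discrete_topology UNIV) UNIV"

lemma openin_pointwise_coord: "openin pointwise_top {f. P (f u)}"
proof -
  have "continuous_map pointwise_top (discrete_topology UNIV) (\<lambda>f. f u)"
    by (rule continuous_map_product_projection) simp
  from openin_continuous_map_preimage[OF this, of "{a. P a}"] show ?thesis by simp
qed

lemma openin_pointwise_coord2: "openin pointwise_top {f. P (f u) (f w)}"
proof -
  have "{f. P (f u) (f w)} = (\<Union>a. {f. f u = a} \<inter> {f. P a (f w)})" by auto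
  also have "openin pointwise_top \<dots>"
    by (intro openin_Union ballI openin_Int | auto intro!: openin_pointwise_coord openin_Int)+
  finally show ?thesis .
qed

lemma closedin_pointwise_coord2: "closedin pointwise_top {f. P (f u) (f w)}"
proof -
  have "UNIV - {f. P (f u) (f w)} = {f. \<not> P (f u) (f w)}" by auto
  then show ?thesis using openin_pointwise_coord2[of "\<lambda>a b. \<not> P a b" u w]
    by (simp add: closedin_def)
qed

text \<open>A basic neighbourhood of the identity restricts finitely many coordinates, and
  automorphisms agree with the identity at those outside \<open>T5_V\<close>.\<close>

lemma openin_T5_top_fixator:
  assumes U: "openin T5_top U" and id: "id \<in> U"
  shows "\<exists>A. finite A \<and> A \<subseteq> T5_V \<and> (\<forall>g\<in>Aut_T5. (\<forall>a\<in>A. g a = a) \<longrightarrow> g \<in> U)"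
proof -
  obtain T where T: "openin pointwise_top T" "U = T \<inter> Aut_T5"
    using U by (auto simp: T5_top_def openin_subtopology)
  then obtain X where X: "finite {i. X i \<noteq> UNIV}" "id \<in> Pi\<^sub>E UNIV X" "Pi\<^sub>E UNIV X \<subseteq> T"
    using id unfolding openin_product_topology_alt by fastforce
  have "g \<in> U" if g: "g \<in> Aut_T5" "\<forall>a\<in>{i. X i \<noteq> UNIV} \<inter> T5_V. g a = a" for g
  proof -
    have "g i \<in> X i" for i
    proof (cases "X i = UNIV")
      case False
      then have "g i = id i" using g Aut_T5_outside by (cases "i \<in> T5_V") auto
      then show ?thesis using X(2) by (auto simp: PiE_iff)
    qed simp
    then show ?thesis using X(3) T(2) g(1) by (auto simp: PiE_iff)
  qed
  then show ?thesis using X(1) by (intro exI[of _ "{i. X i \<noteq> UNIV} \<inter> T5_V"]) auto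
qed

lemma compactin_T5_top_orbit:
  assumes "compactin T5_top U" shows "finite ((\<lambda>g. g p) ` U)"
proof -
  have "compactin pointwise_top U" using assms by (simp add: T5_top_def compactin_subtopology)
  moreover have "continuous_map pointwise_top (discrete_topology UNIV) (\<lambda>f. f p)"
    by (rule continuous_map_product_projection) simp
  ultimately have "compactin (discrete_topology UNIV) ((\<lambda>g. g p) ` U)"
    by (rule image_compactin)
  then show ?thesis by (simp add: compactin_discrete_topology)
qed

lemma stabilizer_open: "openin T5_top {g \<in> Aut_T5. g v = v}"
proof -
  have "{g \<in> Aut_T5. g v = v} = {f. f v = v} \<inter> Aut_T5" by auto
  then show ?thesis using openin_pointwise_coord[of "\<lambda>a. a = v" v]
    by (auto simp: T5_top_def openin_subtopology)
qed

text \<open>By Tychonoff the product of the finite spheres around \<open>v\<close> is compact, and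
  the stabilizer is cut out of it by closed conditions on two coordinates at a time. Surjectivity is
  not such a condition; it follows from the finiteness of the spheres.\<close>

lemma stabilizer_compact:
  assumes v: "v \<in> T5_V" shows "compactin T5_top {g \<in> Aut_T5. g v = v}" (is "compactin _ ?S")
proof -
  \<comment> \<open>The singletons off \<open>T5_V\<close> force members of the product to fix all
    non-vertices.\<close>
  define B where "B w = (if w \<in> T5_V then {z \<in> T5_V. T5_dist v z = T5_dist v w} else {w})" for w
  define C where "C = (\<Inter>(u, w)\<in>T5_V \<times> T5_V.
    {f. (T5_adj u w \<longleftrightarrow> T5_adj (f u) (f w)) \<and> (f u = f w \<longrightarrow> u = w)})"
  have fin: "finite (B w)" for w using finite_T5_sphere[OF v] by (simp add: B_def)
  have comp: "compactin pointwise_top (Pi\<^sub>E UNIV B)"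
    by (simp add: compactin_PiE compactin_discrete_topology fin)
  have closed: "closedin pointwise_top C"
    unfolding C_def using v by (intro closedin_INT) (auto intro: closedin_pointwise_coord2)
  \<comment> \<open>The condition \<open>f v = v\<close> is doubled to fit the two-coordinate form
    of \<open>closedin_pointwise_coord2\<close>.\<close>
  have "?S = Pi\<^sub>E UNIV B \<inter> (C \<inter> {f. f v = v \<and> f v = v})"
  proof (intro equalityI subsetI)
    fix g assume "g \<in> ?S"
    then have g: "g \<in> Aut_T5" "g v = v" by auto
    have "g w \<in> B w" for w
      using T5_dist_Aut[OF g(1), of v w] g Aut_T5_in[OF g(1)] Aut_T5_outside[OF g(1)] by (simp add: B_def)
    moreover have "g \<in> C"
      using Aut_T5_adj[OF g(1)] Aut_T5_bij[OF g(1)] by (auto simp: C_def bij_def dest: injD)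
    ultimately show "g \<in> Pi\<^sub>E UNIV B \<inter> (C \<inter> {f. f v = v \<and> f v = v})" using g by auto
  next
    fix f assume f: "f \<in> Pi\<^sub>E UNIV B \<inter> (C \<inter> {f. f v = v \<and> f v = v})"
    have fB: "f w \<in> B w" for w using f by auto
    have inj: "inj_on f T5_V" using f by (auto simp: C_def inj_on_def)
    \<comment> \<open>An injective map of a finite sphere into itself is onto.\<close>
    have "w \<in> f ` T5_V" if w: "w \<in> T5_V" for w
    proof -
      have "B z = B w" if "z \<in> B w" for z using that w by (auto simp: B_def)
      then have "f ` B w \<subseteq> B w" using fB by blast
      moreover have "inj_on f (B w)" using inj by (rule inj_on_subset) (use w in \<open>auto simp: B_def\<close>)
      ultimately have "f ` B w = B w" using fin by (simp add: endo_inj_surj)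
      moreover have "w \<in> B w" by (simp add: B_def)
      ultimately have "w \<in> f ` B w" by simp
      then show ?thesis using w by (auto simp: B_def)
    qed
    moreover have "f w \<in> T5_V" if "w \<in> T5_V" for w using fB[of w] that by (simp add: B_def)
    ultimately have "bij_betw f T5_V T5_V" using inj by (auto simp: bij_betw_def)
    moreover have "f w = w" if "w \<notin> T5_V" for w using fB[of w] that by (simp add: B_def)
    ultimately show "f \<in> ?S" using f by (auto simp: Aut_T5_def graph_aut_def C_def)
  qed
  also have "compactin pointwise_top \<dots>"
    by (intro compact_Int_closedin comp closedin_Int closed
        closedin_pointwise_coord2[where P = "\<lambda>a b. a = v \<and> b = v"])
  finally show ?thesis by (auto simp: T5_top_def compactin_subtopology)
qed

section \<open>The tree as a Cayley-Abels graph of degree 5\<close>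

lemma T5_degree:
  assumes "v \<in> T5_V" shows "finite {u. T5_adj v u}" "degree T5_adj v = 5"
proof -
  have N: "{u. T5_adj [] u} = (\<lambda>a. [a]) ` {..<5}"
    by (auto simp: T5_adj_def T5_V_iff)
  obtain f where f: "f \<in> Aut_T5" "f [] = v" using assms Aut_T5_from_Nil by blast
  have "{u. T5_adj v u} = f ` {u. T5_adj [] u}"
  proof (intro equalityI subsetI)
    fix u assume "u \<in> {u. T5_adj v u}"
    then have "T5_adj [] (inv f u)" using Aut_T5_adj[OF f(1), of "[]" "inv f u"] f by simp
    then have "f (inv f u) \<in> f ` {u. T5_adj [] u}" by blast
    then show "u \<in> f ` {u. T5_adj [] u}" using f by simp
  next
    fix u assume "u \<in> f ` {u. T5_adj [] u}"
    then obtain w where "T5_adj [] w" "u = f w" by blast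
    then show "u \<in> {u. T5_adj v u}" using Aut_T5_adj[OF f(1), of "[]" w] f by simp
  qed
  then have eq: "{u. T5_adj v u} = (\<lambda>a. f [a]) ` {..<5}" by (simp add: N image_image)
  then show "finite {u. T5_adj v u}" by simp
  have "inj f" using Aut_T5_bij[OF f(1)] by (rule bij_is_inj)
  then have "inj_on (\<lambda>a. f [a]) {..<5}" by (auto simp: inj_on_def dest: injD)
  then show "degree T5_adj v = 5" by (simp add: degree_def eq card_image)
qed

lemma T5_cayley_abels: "cayley_abels_graph Aut_T5 T5_top T5_V T5_adj (\<lambda>g. g)"
proof -
  have "simple_graph T5_V T5_adj" by (auto simp: simple_graph_def T5_adj_def)
  moreover have "connected_graph T5_V T5_adj"
    unfolding connected_graph_def using T5_adj_rtranclp Nil_in_T5_V by blast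
  moreover have "locally_finite_graph T5_V T5_adj"
    using T5_degree(1) by (simp add: locally_finite_graph_def)
  moreover have "graph_aut T5_V T5_adj g" if "g \<in> Aut_T5" for g
    using that by (simp add: Aut_T5_def)
  ultimately show ?thesis
    unfolding cayley_abels_graph_def
    using stabilizer_open stabilizer_compact Aut_T5_transitive by simp
qed

section \<open>Actions with compact open stabilizers\<close>

text \<open>Stands in for indices of stabilizers: applied to two evaluation maps on one set
  \<open>H\<close> of automorphisms, it compares orbit sizes fibre by fibre.\<close>

lemma card_image_fibres:
  assumes fin: "finite (\<phi> ` H)"
    and fib: "\<And>h. h \<in> H \<Longrightarrow> finite (\<psi> ` {k \<in> H. \<phi> k = \<phi> h}) \<and> card (\<psi> ` {k \<in> H. \<phi> k = \<phi> h}) \<le> c"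
  shows "finite (\<psi> ` H)" "card (\<psi> ` H) \<le> c * card (\<phi> ` H)"
proof -
  have eq: "\<psi> ` H = (\<Union>y\<in>\<phi> ` H. \<psi> ` {k \<in> H. \<phi> k = y})" by auto
  show "finite (\<psi> ` H)" unfolding eq by (rule finite_UN_I[OF fin]) (use fib in auto)
  have "card (\<psi> ` H) \<le> (\<Sum>y\<in>\<phi> ` H. card (\<psi> ` {k \<in> H. \<phi> k = y}))"
    unfolding eq by (rule card_UN_le[OF fin])
  also have "\<dots> \<le> (\<Sum>y\<in>\<phi> ` H. c)" by (rule sum_mono) (use fib in auto)
  finally show "card (\<psi> ` H) \<le> c * card (\<phi> ` H)" by (simp add: mult.commute)
qed

text \<open>Openness is recorded as containing the fixator of a finite vertex set, and of
  compactness only the finiteness of the orbits of tree vertices is kept. In this form both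
  properties pass easily from the vertices of a graph to its arcs.\<close>

locale T5_action =
  fixes X :: "'x set" and act :: "(nat list \<Rightarrow> nat list) \<Rightarrow> 'x \<Rightarrow> 'x"
  assumes act_in: "g \<in> Aut_T5 \<Longrightarrow> x \<in> X \<Longrightarrow> act g x \<in> X"
    and act_id: "x \<in> X \<Longrightarrow> act id x = x"
    and act_comp: "g \<in> Aut_T5 \<Longrightarrow> h \<in> Aut_T5 \<Longrightarrow> x \<in> X \<Longrightarrow> act (g \<circ> h) x = act g (act h x)"
    and stab_open: "x \<in> X \<Longrightarrow>
      \<exists>A. finite A \<and> A \<subseteq> T5_V \<and> (\<forall>g\<in>Aut_T5. (\<forall>a\<in>A. g a = a) \<longrightarrow> act g x = x)"
    and stab_compact: "x \<in> X \<Longrightarrow> p \<in> T5_V \<Longrightarrow> finite {g p |g. g \<in> Aut_T5 \<and> act g x = x}"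
begin

lemma act_inv [simp]:
  assumes "g \<in> Aut_T5" "x \<in> X"
  shows "act (inv g) (act g x) = x" "act g (act (inv g) x) = x"
  using act_comp[of "inv g" g x] act_comp[of g "inv g" x] assms act_id by (auto simp: Aut_T5_inv)

lemma act_funpow_Suc:
  "g \<in> Aut_T5 \<Longrightarrow> x \<in> X \<Longrightarrow> act (g ^^ Suc n) x = act (g ^^ n) (act g x)"
  by (simp add: act_comp Aut_T5_funpow funpow_Suc_right del: funpow.simps)

text \<open>The point \<open>act h x\<close> depends only on the restriction of \<open>h\<close> to
  a finite set \<open>A\<close> whose fixator fixes \<open>x\<close>. Elements fixing
  \<open>p\<close> preserve the finite spheres around \<open>p\<close>, which leaves finitely many
  restrictions.\<close>

lemma finite_vertex_stabilizer_orbit: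
  assumes x: "x \<in> X" and p: "p \<in> T5_V"
  shows "finite ((\<lambda>h. act h x) ` {h \<in> Aut_T5. h p = p})"
proof -
  obtain A where A: "finite A" "A \<subseteq> T5_V" "\<And>g. g \<in> Aut_T5 \<Longrightarrow> (\<forall>a\<in>A. g a = a) \<Longrightarrow> act g x = x"
    using stab_open[OF x] by blast
  let ?H = "{h \<in> Aut_T5. h p = p}" and ?act = "\<lambda>h. act h x"
  have "(\<lambda>h. restrict h A) ` ?H \<subseteq> Pi\<^sub>E A (\<lambda>a. {w \<in> T5_V. T5_dist p w = T5_dist p a})"
  proof (clarsimp, intro conjI)
    fix h a assume h: "h \<in> Aut_T5" "h p = p" "a \<in> A"
    show "h a \<in> T5_V" using h A Aut_T5_in by blast
    show "T5_dist p (h a) = T5_dist p a" using T5_dist_Aut[OF h(1), of p a] h by simp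
  qed
  then have fin: "finite ((\<lambda>h. restrict h A) ` ?H)"
    using A(1) finite_T5_sphere[OF p] by (meson finite_PiE finite_subset)
  have sub: "?act ` {k \<in> ?H. restrict k A = restrict h A} \<subseteq> {act h x}" if h: "h \<in> ?H" for h
  proof -
    have "act k x = act h x" if k: "k \<in> Aut_T5" "restrict k A = restrict h A" for k
    proof -
      have "(inv h \<circ> k) a = a" if "a \<in> A" for a
        using fun_cong[OF k(2), of a] that h by simp
      then have "act (inv h \<circ> k) x = x" using h k by (intro A(3)) auto
      then have "act (inv h) (act k x) = x" using h k x by (simp add: act_comp Aut_T5_inv)
      then show ?thesis using h k x act_in act_inv(2)[of h "act k x"] by simp
    qed
    then show ?thesis by auto
  qed
  have "card (?act ` {k \<in> ?H. restrict k A = restrict h A}) \<le> 1" if "h \<in> ?H" for h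
    using card_mono[OF _ sub[OF that]] by simp
  with finite_subset[OF sub] show ?thesis
    by (intro card_image_fibres(1)[OF fin, of _ 1] conjI) simp_all
qed

text \<open>If \<open>g\<close> translates the tree, the orbit of \<open>g\<^sup>n p\<close> under the stabilizer of a vertex \<open>p\<close> on the
  axis has at least \<open>4\<^sup>n\<close> elements, whereas the hypothesis bounds it by a multiple of \<open>3\<^sup>n\<close>.\<close>

lemma small_suborbit_periodic:
  assumes g: "g \<in> Aut_T5" and x: "x \<in> X"
    and fin: "finite {act u (act g x) |u. u \<in> Aut_T5 \<and> act u x = x}"
    and card: "card {act u (act g x) |u. u \<in> Aut_T5 \<and> act u x = x} \<le> 3"
  shows "\<exists>m>0. act (g ^^ m) x = x"
proof -
  have gn: "g ^^ n \<in> Aut_T5" for n using g by (rule Aut_T5_funpow)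
  show ?thesis
    using g
  proof (cases rule: Aut_T5_elliptic_or_translation)
    case (1 p m)
    \<comment> \<open>As \<open>k\<close> fixes \<open>p\<close>, the points
      \<open>act (k ^^ n) x\<close> form a finite set; two of them coincide, and cancelling gives a
      period.\<close>
    define k where "k = g ^^ m"
    have k: "k \<in> Aut_T5" "k p = p" using gn 1 by (auto simp: k_def)
    have kn: "k ^^ n \<in> Aut_T5" "(k ^^ n) p = p" for n
      using k Aut_T5_funpow by (auto, induction n, auto)
    have "range (\<lambda>n. act (k ^^ n) x) \<subseteq> (\<lambda>h. act h x) ` {h \<in> Aut_T5. h p = p}" using kn by auto
    then have "finite (range (\<lambda>n. act (k ^^ n) x))"
      using finite_vertex_stabilizer_orbit[OF x 1(1)] finite_subset by blast
    then have "\<not> inj (\<lambda>n. act (k ^^ n) x)" using finite_imageD by blast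
    then obtain i j where ij: "i < j" "act (k ^^ i) x = act (k ^^ j) x"
      unfolding inj_def by (metis linorder_neqE_nat)
    have "k ^^ j = k ^^ i \<circ> k ^^ (j - i)" using ij by (simp flip: funpow_add)
    then have "act (k ^^ i) x = act (k ^^ i) (act (k ^^ (j - i)) x)"
      using ij kn x act_comp by metis
    then have "act (k ^^ (j - i)) x = x" using kn x act_in act_inv(1) by metis
    moreover have "k ^^ (j - i) = g ^^ (m * (j - i))" by (simp add: k_def funpow_mult mult.commute)
    ultimately show ?thesis using ij 1 by (metis mult_pos_pos zero_less_diff)
  next
    case (2 p)
    let ?H = "{h \<in> Aut_T5. h p = p}"
    define xn where "xn n = act (g ^^ n) x" for n
    have xnX: "xn n \<in> X" for n using gn x act_in by (simp add: xn_def)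
    define a where "a = card ((\<lambda>h. act h x) ` ?H)"
    \<comment> \<open>Each step multiplies the orbit by at most 3: over a fixed image of
      \<open>xn n\<close>, the images of \<open>xn (Suc n)\<close> lie in a translate of the
      stabilizer orbit of \<open>act g x\<close>.\<close>
    have orb: "finite ((\<lambda>h. act h (xn n)) ` ?H) \<and> card ((\<lambda>h. act h (xn n)) ` ?H) \<le> a * 3 ^ n" for n
    proof (induction n)
      case 0
      show ?case using finite_vertex_stabilizer_orbit[OF x 2(1)] x
        by (simp add: xn_def a_def act_id)
    next
      case (Suc n)
      let ?f = "\<lambda>h. act h (xn n)" and ?f' = "\<lambda>h. act h (xn (Suc n))"
      have "finite (?f' ` {k \<in> ?H. ?f k = ?f h}) \<and> card (?f' ` {k \<in> ?H. ?f k = ?f h}) \<le> 3"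
        if h: "h \<in> ?H" for h
      proof -
        let ?O = "{act u (act g x) |u. u \<in> Aut_T5 \<and> act u x = x}"
        have sub: "?f' ` {k \<in> ?H. ?f k = ?f h} \<subseteq> (\<lambda>y. act (h \<circ> g ^^ n) y) ` ?O"
        proof
          fix z assume "z \<in> ?f' ` {k \<in> ?H. ?f k = ?f h}"
          then obtain k where k: "k \<in> Aut_T5" "?f k = ?f h" "z = ?f' k" by auto
          define hg where "hg = h \<circ> g ^^ n"
          have hg: "hg \<in> Aut_T5" using h gn by (auto simp: hg_def)
          \<comment> \<open>Since \<open>k\<close> and \<open>h\<close> agree on
            \<open>xn n\<close>, the quotient \<open>u\<close> fixes \<open>x\<close>.\<close>
          define u where "u = inv hg \<circ> (k \<circ> g ^^ n)"
          have kg: "k \<circ> g ^^ n \<in> Aut_T5" using k gn by auto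
          have u: "u \<in> Aut_T5" using kg hg by (auto simp: u_def)
          have "act (k \<circ> g ^^ n) x = act hg x"
            using k h gn x by (simp add: hg_def act_comp xn_def)
          then have "act u x = x" using hg kg x by (simp add: u_def act_comp Aut_T5_inv)
          moreover have "z = act hg (act u (act g x))"
          proof -
            have gx: "act g x \<in> X" using g x by (rule act_in)
            have "act u (act g x) = act (inv hg) (act (k \<circ> g ^^ n) (act g x))"
              unfolding u_def using hg kg gx by (simp add: act_comp Aut_T5_inv)
            then have "act hg (act u (act g x)) = act (k \<circ> g ^^ n) (act g x)"
              using hg kg gx act_in by simp
            also have "\<dots> = z" using k gn gx act_funpow_Suc[OF g x, of n] by (simp add: act_comp xn_def)
            finally show ?thesis by simp
          qed
          ultimately show "z \<in> (\<lambda>y. act (h \<circ> g ^^ n) y) ` ?O" using u by (auto simp: hg_def)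
        qed
        have "card (?f' ` {k \<in> ?H. ?f k = ?f h}) \<le> card ((\<lambda>y. act (h \<circ> g ^^ n) y) ` ?O)"
          using sub fin by (intro card_mono) auto
        also have "\<dots> \<le> 3" using card card_image_le[OF fin] le_trans by blast
        finally show ?thesis using sub fin finite_subset by blast
      qed
      from card_image_fibres[of ?f ?H ?f' 3, OF conjunct1[OF Suc] this] Suc show ?case by auto
    qed
    define c where "c = card {u p |u. u \<in> Aut_T5 \<and> act u x = x}"
    have finc: "finite {u p |u. u \<in> Aut_T5 \<and> act u x = x}" using stab_compact[OF x 2(1)] .
    \<comment> \<open>The same fibre argument with the tree vertex \<open>(g ^^ n) p\<close> as the
      second point: each fibre lies in a translate of the orbit of \<open>p\<close> under the
      stabilizer of \<open>x\<close>, which has \<open>c\<close> elements.\<close>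
    have bound: "4 ^ n \<le> c * (a * 3 ^ n)" for n
    proof -
      let ?f = "\<lambda>h. act h (xn n)" and ?f' = "\<lambda>h. h ((g ^^ n) p)"
      have "finite (?f' ` {k \<in> ?H. ?f k = ?f h}) \<and> card (?f' ` {k \<in> ?H. ?f k = ?f h}) \<le> c"
        if h: "h \<in> ?H" for h
      proof -
        let ?O = "{u p |u. u \<in> Aut_T5 \<and> act u x = x}"
        have sub: "?f' ` {k \<in> ?H. ?f k = ?f h} \<subseteq> (h \<circ> g ^^ n) ` ?O"
        proof
          fix z assume "z \<in> ?f' ` {k \<in> ?H. ?f k = ?f h}"
          then obtain k where k: "k \<in> Aut_T5" "?f k = ?f h" "z = ?f' k" by auto
          define hg where "hg = h \<circ> g ^^ n"
          have hg: "hg \<in> Aut_T5" using h gn by (auto simp: hg_def)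
          define u where "u = inv hg \<circ> (k \<circ> g ^^ n)"
          have kg: "k \<circ> g ^^ n \<in> Aut_T5" using k gn by auto
          have u: "u \<in> Aut_T5" using kg hg by (auto simp: u_def)
          have "act (k \<circ> g ^^ n) x = act hg x"
            using k h gn x by (simp add: hg_def act_comp xn_def)
          then have "act u x = x" using hg kg x by (simp add: u_def act_comp Aut_T5_inv)
          moreover have "z = hg (u p)" using hg k by (simp add: u_def)
          ultimately show "z \<in> (h \<circ> g ^^ n) ` ?O" using u by (auto simp: hg_def)
        qed
        have "card (?f' ` {k \<in> ?H. ?f k = ?f h}) \<le> card ((h \<circ> g ^^ n) ` ?O)"
          using sub finc by (intro card_mono) auto
        also have "\<dots> \<le> c" unfolding c_def by (rule card_image_le[OF finc])
        finally show ?thesis using sub finc finite_subset by blast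
      qed
      from card_image_fibres(2)[of ?f ?H ?f' c, OF conjunct1[OF orb] this]
      have "card (?f' ` ?H) \<le> c * card (?f ` ?H)" .
      also have "\<dots> \<le> c * (a * 3 ^ n)" using orb by simp
      finally have "card (?f' ` ?H) \<le> c * (a * 3 ^ n)" .
      moreover have "?f' ` ?H = {h ((g ^^ n) p) |h. h \<in> Aut_T5 \<and> h p = p}" by auto
      moreover have "(g ^^ n) p \<in> T5_V" using gn 2 by (simp add: Aut_T5_in)
      ultimately have "4 ^ T5_dist p ((g ^^ n) p) \<le> c * (a * 3 ^ n)"
        using card_stabilizer_orbit[OF 2(1), of "(g ^^ n) p"] by simp
      moreover have "(4::nat) ^ n \<le> 4 ^ T5_dist p ((g ^^ n) p)" using 2(2) by (simp add: power_increasing)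
      ultimately show ?thesis by (rule order_trans[rotated])
    qed
    have "(4/3 :: real) ^ n \<le> real (c * a)" for n
    proof -
      have "real (4 ^ n) \<le> real (c * (a * 3 ^ n))" using bound of_nat_le_iff by blast
      then show ?thesis by (simp add: power_divide field_simps)
    qed
    moreover obtain n where "real (c * a) < (4/3) ^ n"
      using real_arch_pow[of "4/3" "real (c * a)"] by auto
    ultimately show ?thesis by (meson not_le)
  qed
qed

section \<open>Elements that act nontrivially\<close>

lemma three_cycle:
  assumes t: "t \<in> Aut_T5" "t \<circ> t \<circ> t = id" and y: "y \<in> X" "act t y \<noteq> y"
  shows "act t (act t y) \<noteq> y" "act t (act t y) \<noteq> act t y"
proof -
  have *: "act t (act t (act t y)) = y"
    using t y act_comp[of "t \<circ> t" t y] act_comp[of t t "act t y"] act_id act_in by (simp add: Aut_T5_comp)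
  show "act t (act t y) \<noteq> y" using * y by auto
  show "act t (act t y) \<noteq> act t y" using * y by auto
qed

text \<open>If \<open>t\<close> acted trivially, so would its conjugates, which would then all
  stabilize \<open>x\<close>. They move the root arbitrarily far, whereas the root has a finite
  orbit under that stabilizer.\<close>

lemma unbounded_displacement_acts_nontrivially:
  assumes t: "t \<in> Aut_T5" and disp: "\<And>n. \<exists>y\<in>T5_V. n < T5_dist y (t y)"
    and ne: "X \<noteq> {}"
  shows "\<exists>x\<in>X. act t x \<noteq> x"
proof (rule ccontr)
  assume triv: "\<not> (\<exists>x\<in>X. act t x \<noteq> x)"
  obtain x where x: "x \<in> X" using ne by blast
  let ?O = "{g [] |g. g \<in> Aut_T5 \<and> act g x = x}"
  have "finite (length ` ?O)" using stab_compact[OF x] by simp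
  then obtain M where M: "\<And>w. w \<in> ?O \<Longrightarrow> length w \<le> M"
    by (meson finite_nat_set_iff_bounded_le imageI)
  obtain y where y: "y \<in> T5_V" "M < T5_dist y (t y)" using disp by blast
  obtain h where h: "h \<in> Aut_T5" "h [] = y" using Aut_T5_from_Nil y by blast
  define k where "k = inv h \<circ> t \<circ> h"
  have k: "k \<in> Aut_T5" using h t by (auto simp: k_def)
  have "act k x = act (inv h) (act t (act h x))"
    unfolding k_def using h t x by (simp add: act_comp act_in Aut_T5_inv Aut_T5_comp)
  also have "\<dots> = x" using triv h x act_in by simp
  finally have "length (k []) \<le> M" using M k by blast
  moreover have "length (k []) = T5_dist y (t y)"
  proof -
    have "k [] \<in> T5_V" using k by (simp add: Aut_T5_in)
    moreover have "h (k []) = t y" using h by (simp add: k_def)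
    ultimately show ?thesis
      using T5_dist_Aut[OF h(1), of "[]" "k []"] T5_dist_Nil[of "k []"] h by simp
  qed
  ultimately show False using y by simp
qed

end

section \<open>Elements of order three\<close>

lemma ex_T5_word_ending: "\<exists>b\<in>T5_V. n < length b \<and> last b = 0"
proof (induction n)
  case 0
  show ?case by (rule bexI[of _ "[0]"]) (auto simp: T5_V_Cons)
next
  case (Suc n)
  then obtain b where "b \<in> T5_V" "n < length b" "last b = 0" by blast
  then show ?case by (intro bexI[of _ "(b @ [1]) @ [0]"]) (auto simp: T5_V_snoc simp del: append_assoc)
qed

lemma ex_T5_word_starting: "\<exists>w. length w = n \<and> 1 # w \<in> T5_V"
proof (induction n)
  case 0
  show ?case by (auto simp: T5_V_Cons)
next
  case (Suc n)
  then obtain w where w: "length w = n" "1 # w \<in> T5_V" by blast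
  have "(1 # w) @ [if last (1 # w) = 0 then 1 else 0] \<in> T5_V" using w by (simp only: T5_V_snoc) auto
  then show ?case using w by (intro exI[of _ "w @ [if last (1 # w) = 0 then 1 else 0]"]) auto
qed

text \<open>A 3-cycle of letters is applied on the branch behind a word \<open>b\<close> that is
  longer than all words in \<open>A\<close> and ends in a letter fixed by the cycle. A word
  \<open>b @ 1 # w\<close> is displaced by twice the length of \<open>1 # w\<close>.\<close>

lemma ex_order_three:
  assumes A: "finite A"
  shows "\<exists>t\<in>Aut_T5. t \<circ> t \<circ> t = id \<and> (\<forall>a\<in>A. t a = a) \<and> (\<forall>n. \<exists>y\<in>T5_V. n < T5_dist y (t y))"
proof -
  \<comment> \<open>The cycle sending 1 to 2, 2 to 3 and 3 to 1.\<close>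
  define \<pi> :: "nat \<Rightarrow> nat" where "\<pi> = Transposition.transpose 1 2 \<circ> Transposition.transpose 2 3"
  have p: "\<pi> permutes {..<5}" unfolding \<pi>_def by (intro permutes_compose permutes_swap_id) auto
  have p3: "\<pi> (\<pi> (\<pi> a)) = a" for a by (auto simp: \<pi>_def Transposition.transpose_def)
  have p0: "\<pi> 0 = 0" "\<pi> 1 \<noteq> 1" by (auto simp: \<pi>_def Transposition.transpose_def)
  obtain M where M: "\<And>a. a \<in> A \<Longrightarrow> length a \<le> M"
    using A by (meson finite_imageI finite_nat_set_iff_bounded_le imageI)
  obtain b where b: "b \<in> T5_V" "M < length b" "last b = 0" using ex_T5_word_ending by blast
  define t where "t = branch_perm b \<pi>"
  have l: "\<pi> (last b) = last b" using b p0 by simp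
  have t: "t \<in> Aut_T5" unfolding t_def by (rule branch_perm_Aut[OF p l])
  have ext: "b @ w \<in> T5_V" if "1 # w' = w" "w \<in> T5_V" for w w'
    using b that by (auto simp: T5_V_iff successively_append_iff)
  have "t (t (t w)) = w" for w
  proof (cases "w \<in> T5_V \<and> take (length b) w = b")
    case True
    then obtain u where u: "w = b @ u" by (metis append_take_drop_id)
    have "b @ u \<in> T5_V" using True u by simp
    then show ?thesis using branch_perm_in[OF p l, of u] branch_perm_in[OF p l, of "map \<pi> u"]
      by (simp add: u t_def branch_perm_append p3 comp_def)
  qed (auto simp: t_def branch_perm_def)
  moreover have "t a = a" if "a \<in> A" for a
  proof -
    have "length (take (length b) a) < length b" using M[OF that] b by simp
    then have "take (length b) a \<noteq> b" by (metis less_irrefl)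
    then show ?thesis by (simp add: t_def branch_perm_other)
  qed
  moreover have "\<exists>y\<in>T5_V. n < T5_dist y (t y)" for n
  proof -
    obtain w where w: "length w = n" "1 # w \<in> T5_V" using ex_T5_word_starting by blast
    define y where "y = b @ 1 # w"
    have y: "y \<in> T5_V" using ext w by (simp add: y_def)
    have "t y = b @ map \<pi> (1 # w)" using y by (simp add: t_def y_def branch_perm_append)
    moreover from this have "b @ map \<pi> (1 # w) \<in> T5_V" using t y Aut_T5_in by metis
    ultimately have "T5_dist y (t y) = T5_dist (1 # w) (map \<pi> (1 # w))"
      using T5_dist_lmulw y by (simp add: y_def)
    also have "\<dots> = length (1 # w) + length (map \<pi> (1 # w))"
      using w p0 T5_V_appendD(2)[OF \<open>b @ map \<pi> (1 # w) \<in> T5_V\<close>] by (intro T5_dist_diverge) auto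
    finally have "n < T5_dist y (t y)" using w by simp
    then show ?thesis using y by blast
  qed
  ultimately show ?thesis using t by (intro bexI[of _ t]) (auto simp: fun_eq_iff)
qed

section \<open>Paths of a reversible invariant relation\<close>

text \<open>The common form of the two cases: arcs with \<open>prod.swap\<close> as
  \<open>flip\<close>, and vertices with an equivariant involution as \<open>flip\<close>. Paths of
  \<open>R\<close> are reversed by reading them backwards through \<open>flip\<close>.\<close>

locale T5_reversible = T5_action +
  fixes R :: "'x \<Rightarrow> 'x \<Rightarrow> bool" and flip :: "'x \<Rightarrow> 'x"
  assumes nonempty: "X \<noteq> {}"
    and transitive: "x \<in> X \<Longrightarrow> y \<in> X \<Longrightarrow> \<exists>g\<in>Aut_T5. act g x = y"
    and R_in: "R x y \<Longrightarrow> x \<in> X \<and> y \<in> X"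
    and R_act: "g \<in> Aut_T5 \<Longrightarrow> R x y \<Longrightarrow> R (act g x) (act g y)"
    and R_ex: "x \<in> X \<Longrightarrow> \<exists>y. R x y"
    and R_card: "x \<in> X \<Longrightarrow> finite {y. R x y} \<and> card {y. R x y} \<le> 3"
    and flip_in: "x \<in> X \<Longrightarrow> flip x \<in> X"
    and flip_flip: "x \<in> X \<Longrightarrow> flip (flip x) = x"
    and flip_act: "g \<in> Aut_T5 \<Longrightarrow> x \<in> X \<Longrightarrow> flip (act g x) = act g (flip x)"
    and R_flip: "R x y \<Longrightarrow> R (flip y) (flip x)"
    and connected: "Y \<subseteq> X \<Longrightarrow> Y \<noteq> {} \<Longrightarrow> (\<And>x y. x \<in> Y \<Longrightarrow> R x y \<Longrightarrow> y \<in> Y) \<Longrightarrow>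
      (\<And>x. x \<in> Y \<Longrightarrow> flip x \<in> Y) \<Longrightarrow> Y = X"
begin

definition path :: "nat \<Rightarrow> 'x list \<Rightarrow> bool" where
  "path n p \<longleftrightarrow> length p = Suc n \<and> set p \<subseteq> X \<and> successively R p"

lemma path_snoc: "path (Suc n) (p @ [y]) \<longleftrightarrow> path n p \<and> R (last p) y"
  using R_in by (cases "p = []") (auto simp: path_def successively_append_iff)

lemma path_last_in: "path n p \<Longrightarrow> last p \<in> X"
  unfolding path_def by (metis last_in_set list.size(3) nat.distinct(1) subsetD)

lemma path_ex: "\<exists>p. path n p"
proof (induction n)
  case 0
  obtain x where "x \<in> X" using nonempty by blast
  then have "path 0 [x]" by (simp add: path_def)
  then show ?case by blast
next
  case (Suc n)
  then obtain p where p: "path n p" by blast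
  then obtain y where "R (last p) y" using R_ex path_last_in by blast
  then show ?case using p path_snoc by blast
qed

lemma path_shift:
  assumes "path n p" "R (last p) y" shows "path n (tl p @ [y])"
proof -
  obtain x q where p: "p = x # q" using assms by (cases p) (auto simp: path_def)
  show ?thesis using assms R_in[OF assms(2)]
    by (cases "q = []") (auto simp: p path_def successively_append_iff successively_Cons)
qed

lemma path_flip:
  assumes "path n p" shows "path n (rev (map flip p))"
proof -
  have "successively (\<lambda>x y. R (flip y) (flip x)) p"
    using assms by (auto simp: path_def intro: successively_mono R_flip)
  then show ?thesis using assms by (auto simp: path_def successively_map flip_in)
qed

text \<open>The path fixed by \<open>t\<close> can crawl forward like a snake and turn round by reversal,
  so that \<open>t\<close> fixes everything it reaches.\<close>

lemma order_three_moves_successor: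
  "\<exists>p t y. path n p \<and> t \<in> Aut_T5 \<and> t \<circ> t \<circ> t = id \<and> (\<forall>x\<in>set p. act t x = x) \<and>
     R (last p) y \<and> act t y \<noteq> y"
proof (rule ccontr)
  assume neg: "\<not> ?thesis"
  obtain p0 where p0: "path n p0" using path_ex by blast
  have "\<forall>x\<in>set p0. \<exists>A. finite A \<and> A \<subseteq> T5_V \<and> (\<forall>g\<in>Aut_T5. (\<forall>a\<in>A. g a = a) \<longrightarrow> act g x = x)"
    using p0 stab_open unfolding path_def by (meson subsetD)
  then obtain F where F: "\<And>x. x \<in> set p0 \<Longrightarrow> finite (F x)"
    "\<And>x g. x \<in> set p0 \<Longrightarrow> g \<in> Aut_T5 \<Longrightarrow> (\<forall>a\<in>F x. g a = a) \<Longrightarrow> act g x = x"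
    by metis
  have "finite (\<Union>(F ` set p0))" using F(1) by simp
  then obtain t where t: "t \<in> Aut_T5" "t \<circ> t \<circ> t = id" "\<And>a. a \<in> \<Union>(F ` set p0) \<Longrightarrow> t a = a"
    "\<And>n. \<exists>y\<in>T5_V. n < T5_dist y (t y)"
    using ex_order_three by metis
  \<comment> \<open>\<open>S\<close> collects the paths of \<open>n\<close> steps fixed pointwise by
    \<open>t\<close>; under the negated claim, \<open>t\<close> also fixes every continuation of
    such a path.\<close>
  define S where "S p \<longleftrightarrow> path n p \<and> (\<forall>x\<in>set p. act t x = x)" for p
  have S0: "S p0" using p0 F(2) t by (auto simp: S_def)
  have SX: "set p \<subseteq> X" if "S p" for p using that by (simp add: S_def path_def)
  have Sne: "p \<noteq> []" if "S p" for p using that by (auto simp: S_def path_def)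
  have shift: "S (tl p @ [y])" if "S p" "R (last p) y" for p y
  proof -
    have "act t y = y" using neg that t(1,2) by (auto simp: S_def)
    then show ?thesis using that path_shift Sne[OF that(1)] by (auto simp: S_def dest: list.set_sel(2))
  qed
  have flipS: "S (rev (map flip p))" if "S p" for p
    using that path_flip SX[OF that] flip_act[OF t(1)] by (fastforce simp: S_def)
  \<comment> \<open>Crawling forward \<open>i\<close> steps drops the first \<open>i\<close> points,
    which brings \<open>p ! i\<close> to the front.\<close>
  have front: "\<exists>q. S q \<and> hd q = p ! i" if "S p" "i < length p" for p i
    using that
  proof (induction i arbitrary: p)
    case 0
    then show ?case using hd_conv_nth by fastforce
  next
    case (Suc i)
    have "last p \<in> X" using path_last_in Suc.prems by (auto simp: S_def)
    then obtain y where y: "R (last p) y" using R_ex by blast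
    have "(tl p @ [y]) ! i = p ! Suc i" using Suc.prems by (auto simp: nth_append nth_tl)
    moreover have "i < length (tl p @ [y])" using Suc.prems by simp
    ultimately show ?case using Suc.IH shift[OF Suc.prems(1) y] by metis
  qed
  define Y where "Y = \<Union>(set ` {p. S p})"
  have Y_flip: "flip x \<in> Y" if x: "x \<in> Y" for x
  proof -
    obtain p where p: "S p" "x \<in> set p" using x by (auto simp: Y_def)
    have "flip x \<in> set (rev (map flip p))" using p by simp
    then show ?thesis using flipS[OF p(1)] unfolding Y_def by blast
  qed
  have last_flip: "\<exists>q. S q \<and> last q = flip x" if x: "x \<in> Y" for x
  proof -
    obtain q where q: "S q" "hd q = x" using x front by (auto simp: Y_def in_set_conv_nth)
    have "last (rev (map flip q)) = flip x" using q Sne[OF q(1)] by (simp add: last_rev hd_map)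
    then show ?thesis using flipS q by blast
  qed
  have YX: "Y \<subseteq> X" using SX by (auto simp: Y_def)
  have "Y = X"
  proof (rule connected[OF YX])
    show "Y \<noteq> {}" using S0 Sne[OF S0] by (force simp: Y_def)
    show "y \<in> Y" if x: "x \<in> Y" and R: "R x y" for x y
    proof -
      obtain q where q: "S q" "last q = x"
        \<comment> \<open>Reversing twice: \<open>last_flip\<close> at \<open>flip x\<close> yields
          a fixed path that ends in \<open>x\<close> itself.\<close>
        using last_flip[OF Y_flip[OF x]] flip_flip x YX by auto
      have "y \<in> set (tl q @ [y])" by simp
      then show ?thesis using shift[of q y] q R unfolding Y_def by blast
    qed
  qed (rule Y_flip)
  then have "\<forall>x\<in>X. act t x = x" by (auto simp: Y_def S_def)
  then show False using unbounded_displacement_acts_nontrivially[OF t(1,4) nonempty] by blast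
qed

text \<open>Some path \<open>p0\<close> is fixed by an order-three element that moves a
  continuation. This element permutes the at most three continuations of \<open>p0\<close>
  cyclically, so transitivity on paths of \<open>n\<close> steps extends by one step.\<close>

lemma paths_transitive:
  "path n p \<Longrightarrow> path n q \<Longrightarrow> \<exists>g\<in>Aut_T5. map (act g) p = q"
proof (induction n arbitrary: p q)
  case 0
  then obtain x y where "p = [x]" "q = [y]" "x \<in> X" "y \<in> X"
    by (auto simp: path_def length_Suc_conv)
  then show ?case using transitive[of x y] by auto
next
  case (Suc n)
  obtain p0 t y0 where p0: "path n p0" and t: "t \<in> Aut_T5" "t \<circ> t \<circ> t = id"
    and fix_p0: "\<forall>x\<in>set p0. act t x = x" and y0: "R (last p0) y0" "act t y0 \<noteq> y0"
    using order_three_moves_successor by metis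
  have y0X: "y0 \<in> X" using R_in y0 by blast
  have p0X: "set p0 \<subseteq> X" "p0 \<noteq> []" using p0 by (auto simp: path_def)
  have tl: "act t (last p0) = last p0" using fix_p0 p0X by simp
  have succ: "R (last p0) (act t y0)" "R (last p0) (act t (act t y0))"
    using R_act[OF t(1)] y0 tl by metis+
  \<comment> \<open>The three images of \<open>y0\<close> are distinct, hence exhaust the
    successors.\<close>
  have all: "{y. R (last p0) y} = {y0, act t y0, act t (act t y0)}"
  proof (rule card_seteq[symmetric])
    show "finite {y. R (last p0) y}" using R_card path_last_in[OF p0] by blast
    show "{y0, act t y0, act t (act t y0)} \<subseteq> {y. R (last p0) y}" using succ y0 by auto
    show "card {y. R (last p0) y} \<le> card {y0, act t y0, act t (act t y0)}"
      using R_card[OF path_last_in[OF p0]] three_cycle[OF t y0X y0(2)] y0(2) by auto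
  qed
  have reach: "\<exists>s\<in>Aut_T5. (\<forall>x\<in>set p0. act s x = x) \<and> act s y0 = z" if z: "R (last p0) z" for z
  proof -
    consider "z = y0" | "z = act t y0" | "z = act t (act t y0)" using z all by blast
    then show ?thesis
    proof cases
      case 1
      then show ?thesis using p0X y0X act_id by (intro bexI[of _ id]) auto
    next
      case 2
      then show ?thesis using t fix_p0 by blast
    next
      case 3
      then show ?thesis using t fix_p0 p0X y0X
        by (intro bexI[of _ "t \<circ> t"]) (auto simp: act_comp)
    qed
  qed
  \<comment> \<open>First \<open>g\<close> moves \<open>p0\<close> to the initial part of
    \<open>r\<close>; then \<open>s\<close>, which fixes \<open>p0\<close>, corrects the last
    point.\<close>
  have from_p0: "\<exists>g\<in>Aut_T5. map (act g) (p0 @ [y0]) = r" if r: "path (Suc n) r" for r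
  proof -
    obtain r' y where r': "r = r' @ [y]" using r by (cases r rule: rev_cases) (auto simp: path_def)
    then have ry: "path n r'" "R (last r') y" using r path_snoc by auto
    obtain g where g: "g \<in> Aut_T5" "map (act g) p0 = r'" using Suc.IH p0 ry by blast
    have "R (act (inv g) (last r')) (act (inv g) y)" using R_act Aut_T5_inv g ry by blast
    moreover have "last r' = act g (last p0)" using g p0X by (metis last_map)
    ultimately have "R (last p0) (act (inv g) y)" using g path_last_in[OF p0] by simp
    then obtain s where s: "s \<in> Aut_T5" "\<forall>x\<in>set p0. act s x = x" "act s y0 = act (inv g) y"
      using reach by blast
    have "act (g \<circ> s) y0 = y" using g s y0X R_in[OF ry(2)] by (simp add: act_comp)
    moreover have "map (act (g \<circ> s)) p0 = r'"
      using g s p0X act_comp by (auto intro!: map_cong simp flip: g(2))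
    ultimately show ?thesis using g s r' by (intro bexI[of _ "g \<circ> s"]) auto
  qed
  obtain f g where f: "f \<in> Aut_T5" "map (act f) (p0 @ [y0]) = p"
    and g: "g \<in> Aut_T5" "map (act g) (p0 @ [y0]) = q"
    using from_p0 Suc.prems by metis
  have "act (g \<circ> inv f) (act f x) = act g x" if "x \<in> X" for x
    using that f g act_in by (simp add: act_comp Aut_T5_inv)
  then have "map (act (g \<circ> inv f)) p = q"
    using p0X y0X unfolding f(2)[symmetric] g(2)[symmetric] by auto
  then show ?case using Aut_T5_comp[OF g(1) Aut_T5_inv[OF f(1)]] by blast
qed

text \<open>With \<open>y = act g x\<close> a successor of \<open>x\<close>, the suborbit bound
  gives \<open>act (g ^^ m) x = x\<close>, so the path \<open>p\<close> along the powers of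
  \<open>g\<close> returns to \<open>x\<close> and contains \<open>y\<close>. It continues to both
  \<open>y\<close> and \<open>act t y\<close>; an element matching these two continuations would fix
  \<open>p\<close>, hence \<open>y\<close>, and yet move \<open>y\<close>.\<close>

lemma absurd: False
proof -
  obtain p0 t y where p0: "path 0 p0" and t: "t \<in> Aut_T5" "\<forall>x\<in>set p0. act t x = x"
    and y: "R (last p0) y" "act t y \<noteq> y"
    using order_three_moves_successor by metis
  obtain x where x: "p0 = [x]" "x \<in> X" using p0 by (auto simp: path_def length_Suc_conv)
  have xy: "R x y" "R x (act t y)" using y x t R_act[OF t(1), of x y] by auto
  obtain g where g: "g \<in> Aut_T5" "act g x = y" using transitive x R_in xy by metis
  have sub: "{act u (act g x) |u. u \<in> Aut_T5 \<and> act u x = x} \<subseteq> {z. R x z}"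
    using R_act xy(1) g(2) by (smt (verit) mem_Collect_eq subsetI)
  then have "finite {act u (act g x) |u. u \<in> Aut_T5 \<and> act u x = x}"
    "card {act u (act g x) |u. u \<in> Aut_T5 \<and> act u x = x} \<le> 3"
    using R_card[OF x(2)] finite_subset card_mono[OF _ sub] by (auto intro: le_trans)
  then obtain m where m: "m > 0" "act (g ^^ m) x = x"
    using small_suborbit_periodic[OF g(1) x(2)] by blast
  define p where "p = map (\<lambda>i. act (g ^^ i) x) [0..<Suc m]"
  have "path k (map (\<lambda>i. act (g ^^ i) x) [0..<Suc k])" for k
  proof (induction k)
    case 0
    then show ?case using x by (simp add: path_def act_id)
  next
    case (Suc k)
    have "R (act (g ^^ k) x) (act (g ^^ k) (act g x))"
      using R_act Aut_T5_funpow g xy by blast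
    then have "R (act (g ^^ k) x) (act (g ^^ Suc k) x)" using act_funpow_Suc[OF g(1) x(2)] by metis
    with Suc show ?case using path_snoc[of k "map (\<lambda>i. act (g ^^ i) x) [0..<Suc k]" "act (g ^^ Suc k) x"]
      by simp
  qed
  then have p: "path m p" unfolding p_def .
  have "last p = x" using m by (simp add: p_def)
  then have "path (Suc m) (p @ [y])" "path (Suc m) (p @ [act t y])" using p xy path_snoc by auto
  then obtain h where h: "map (act h) (p @ [y]) = p @ [act t y]" using paths_transitive by metis
  \<comment> \<open>The point \<open>y\<close> has index 1 in \<open>p\<close>, which exists because
    \<open>m > 0\<close>.\<close>
  have "y \<in> set p"
  proof -
    have "p ! 1 = y" using m g by (simp add: p_def nth_append del: upt_Suc)
    moreover have "length p = Suc m" by (simp add: p_def)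
    ultimately show ?thesis using m by (metis One_nat_def Suc_less_eq nth_mem)
  qed
  then obtain i where "i < length p" "p ! i = y" by (meson in_set_conv_nth)
  moreover have "map (act h) p = p" using h by simp
  ultimately have "act h y = y" by (metis nth_map)
  moreover have "act h y = act t y" using h by simp
  ultimately show False using y by simp
qed

end

section \<open>Graphs of degree at most four\<close>

locale T5_small_graph =
  fixes W :: "'v set" and E :: "'v \<Rightarrow> 'v \<Rightarrow> bool" and act :: "(nat list \<Rightarrow> nat list) \<Rightarrow> 'v \<Rightarrow> 'v"
  assumes cayley_abels: "cayley_abels_graph Aut_T5 T5_top W E act"
    and small: "\<exists>v\<in>W. degree E v \<le> 4"
begin

lemma E_in: "E u v \<Longrightarrow> u \<in> W \<and> v \<in> W"
  and E_sym: "E u v \<Longrightarrow> E v u"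
  and W_nonempty: "W \<noteq> {}"
  and finite_nbrs: "v \<in> W \<Longrightarrow> finite {u. E v u}"
  and W_transitive: "v \<in> W \<Longrightarrow> w \<in> W \<Longrightarrow> \<exists>g\<in>Aut_T5. act g v = w"
  using cayley_abels
  unfolding cayley_abels_graph_def simple_graph_def connected_graph_def locally_finite_graph_def
  by blast+

sublocale T5_action W act
proof
  have aut: "bij_betw (act g) W W" if "g \<in> Aut_T5" for g
    using cayley_abels that by (auto simp: cayley_abels_graph_def graph_aut_def)
  show "act g x \<in> W" if "g \<in> Aut_T5" "x \<in> W" for g x
    using aut[OF that(1)] that(2) by (auto simp: bij_betw_def)
  show "act id x = x" if "x \<in> W" for x
    using cayley_abels that by (simp add: cayley_abels_graph_def)
  then have id: "id \<in> {g \<in> Aut_T5. act g x = x}" if "x \<in> W" for x using that by simp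
  show "act (g \<circ> h) x = act g (act h x)" if "g \<in> Aut_T5" "h \<in> Aut_T5" "x \<in> W" for g h x
    using cayley_abels that by (simp add: cayley_abels_graph_def)
  have co: "openin T5_top {g \<in> Aut_T5. act g x = x}" "compactin T5_top {g \<in> Aut_T5. act g x = x}"
    if "x \<in> W" for x
    using cayley_abels that by (simp_all add: cayley_abels_graph_def)
  show "\<exists>A. finite A \<and> A \<subseteq> T5_V \<and> (\<forall>g\<in>Aut_T5. (\<forall>a\<in>A. g a = a) \<longrightarrow> act g x = x)"
    if "x \<in> W" for x
    using openin_T5_top_fixator[OF co(1)[OF that] id[OF that]] by simp
  show "finite {g p |g. g \<in> Aut_T5 \<and> act g x = x}" if "x \<in> W" "p \<in> T5_V" for x p
    using compactin_T5_top_orbit[OF co(2)[OF that(1)], of p] by (simp add: setcompr_eq_image)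
qed

lemma E_act:
  assumes g: "g \<in> Aut_T5" and E: "E u v" shows "E (act g u) (act g v)"
  using cayley_abels assms E_in[OF E] unfolding cayley_abels_graph_def graph_aut_def by blast

lemma card_nbrs_eq:
  assumes "v \<in> W" "w \<in> W" shows "card {u. E v u} = card {u. E w u}"
proof -
  have "card {u. E v u} \<le> card {u. E w u}" if vw: "v \<in> W" "w \<in> W" for v w
  proof -
    obtain g where g: "g \<in> Aut_T5" "act g v = w" using W_transitive vw by blast
    show ?thesis
    proof (rule card_inj_on_le)
      show "inj_on (act g) {u. E v u}"
        using g E_in act_inv(1) by (metis inj_onI mem_Collect_eq)
      show "act g ` {u. E v u} \<subseteq> {u. E w u}" using E_act g by auto
    qed (use finite_nbrs vw in blast)
  qed
  then show ?thesis using assms by (meson antisym)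
qed

lemma card_nbrs_le: "v \<in> W \<Longrightarrow> card {u. E v u} \<le> 4"
  using small card_nbrs_eq by (metis degree_def)

lemma E_connected:
  assumes Y: "Y \<subseteq> W" "Y \<noteq> {}" and closed: "\<And>u v. u \<in> Y \<Longrightarrow> E u v \<Longrightarrow> v \<in> Y"
  shows "Y = W"
proof
  obtain y where y: "y \<in> Y" using Y by blast
  show "W \<subseteq> Y"
  proof
    fix w assume "w \<in> W"
    then have "E\<^sup>*\<^sup>* y w"
      using cayley_abels Y y unfolding cayley_abels_graph_def connected_graph_def by blast
    then show "w \<in> Y" by (induction rule: rtranclp_induct) (use y closed in auto)
  qed
qed (rule Y)

section \<open>Suborbits on the neighbours of a vertex\<close>

definition suborbit :: "'v \<Rightarrow> 'v \<Rightarrow> 'v set" where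
  "suborbit v w = {act u w |u. u \<in> Aut_T5 \<and> act u v = v}"

lemma suborbit_sub: "E v w \<Longrightarrow> suborbit v w \<subseteq> {u. E v u}"
  unfolding suborbit_def using E_act by (smt (verit) mem_Collect_eq subsetI)

text \<open>An order-three element fixing \<open>v\<close> but moving a neighbour yields three
  points in a suborbit. Without such neighbours, an element fixing one vertex would by connectedness
  fix all, against its nontrivial action.\<close>

lemma ex_large_suborbit: "\<exists>v w. E v w \<and> 3 \<le> card (suborbit v w)"
proof (rule ccontr)
  assume neg: "\<not> ?thesis"
  obtain v0 where v0: "v0 \<in> W" using W_nonempty by blast
  obtain A where A: "finite A" "\<And>g. g \<in> Aut_T5 \<Longrightarrow> (\<forall>a\<in>A. g a = a) \<Longrightarrow> act g v0 = v0"
    using stab_open[OF v0] by blast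
  obtain t where t: "t \<in> Aut_T5" "t \<circ> t \<circ> t = id" "\<And>a. a \<in> A \<Longrightarrow> t a = a"
    "\<And>n. \<exists>y\<in>T5_V. n < T5_dist y (t y)"
    using ex_order_three[OF A(1)] by metis
  have "{v \<in> W. act t v = v} = W"
  proof (rule E_connected)
    show "{v \<in> W. act t v = v} \<noteq> {}" using v0 A(2)[OF t(1)] t(3) by blast
    fix v w assume v: "v \<in> {v \<in> W. act t v = v}" and E: "E v w"
    have w: "w \<in> W" using E_in[OF E] by blast
    have "act t w = w"
    proof (rule ccontr)
      assume ne: "act t w \<noteq> w"
      have "act (t \<circ> t) v = v" "act id v = v" using v t act_comp act_id by auto
      then have sub: "{w, act t w, act t (act t w)} \<subseteq> suborbit v w"
        unfolding suborbit_def using v w t act_id[OF w] act_comp[OF t(1) t(1) w]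
        by (auto intro: exI[of _ id] exI[of _ t] exI[of _ "t \<circ> t"])
      have "finite (suborbit v w)"
        using suborbit_sub[OF E] finite_nbrs v finite_subset by blast
      from card_mono[OF this sub] have "3 \<le> card (suborbit v w)"
        using three_cycle[OF t(1,2) w ne] ne by simp
      then show False using neg E by blast
    qed
    then show "w \<in> {v \<in> W. act t v = v}" using w by blast
  qed auto
  then show False
    using unbounded_displacement_acts_nontrivially[OF t(1,4) W_nonempty] by blast
qed

text \<open>The action is transitive on arcs, and non-backtracking continuation is a reversible
  relation on them. Degree at least 3 provides successors, degree at most 4 bounds their number by
  3.\<close>

lemma arc_transitive_absurd:
  assumes vw: "E v w" and card: "3 \<le> card {u. E v u}" and orb: "suborbit v w = {u. E v u}"
  shows False
proof -
  define X where "X = {(a, b). E a b}"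
  define act2 where "act2 g = map_prod (act g) (act g)" for g
  define R where "R x y \<longleftrightarrow> x \<in> X \<and> y \<in> X \<and> fst y = snd x \<and> snd y \<noteq> fst x" for x y
  have XI: "x \<in> X \<longleftrightarrow> E (fst x) (snd x)" for x by (auto simp: X_def)
  have XW: "fst x \<in> W" "snd x \<in> W" if "x \<in> X" for x using that E_in by (auto simp: XI)
  have card3: "3 \<le> card {u. E a u}" if "a \<in> W" for a
    using card card_nbrs_eq[of v a] E_in[OF vw] that by simp
  \<comment> \<open>The tail of the arc is moved to \<open>v\<close>; an element of the stabilizer
    of \<open>v\<close> then corrects the head.\<close>
  have to_vw: "\<exists>g\<in>Aut_T5. act2 g x = (v, w)" if x: "x \<in> X" for x
  proof -
    obtain g where g: "g \<in> Aut_T5" "act g (fst x) = v"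
      using W_transitive XW(1)[OF x] E_in[OF vw] by blast
    have "E v (act g (snd x))" using E_act[OF g(1), of "fst x" "snd x"] x g by (simp add: XI)
    then obtain u where u: "u \<in> Aut_T5" "act u v = v" "act u w = act g (snd x)"
      using orb unfolding suborbit_def by (smt (verit) mem_Collect_eq)
    have "act (inv u) v = v" "act (inv u) (act g (snd x)) = w"
      using act_inv(1)[OF u(1)] u(2,3) E_in[OF vw] by metis+
    then have "act2 (inv u \<circ> g) x = (v, w)"
      using u g XW[OF x] by (cases x) (simp add: act2_def act_comp Aut_T5_inv)
    then show ?thesis using u g by (intro bexI[of _ "inv u \<circ> g"]) auto
  qed
  interpret arcs: T5_action X act2
  proof
    show "act2 g x \<in> X" if "g \<in> Aut_T5" "x \<in> X" for g x
      using that E_act by (auto simp: act2_def X_def)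
    show "act2 id x = x" if "x \<in> X" for x
      using XW[OF that] act_id by (cases x) (simp add: act2_def)
    show "act2 (g \<circ> h) x = act2 g (act2 h x)" if "g \<in> Aut_T5" "h \<in> Aut_T5" "x \<in> X" for g h x
      using XW[OF that(3)] that(1,2) act_comp by (cases x) (simp add: act2_def)
    show "\<exists>A. finite A \<and> A \<subseteq> T5_V \<and> (\<forall>g\<in>Aut_T5. (\<forall>a\<in>A. g a = a) \<longrightarrow> act2 g x = x)"
      if x: "x \<in> X" for x
    proof -
      obtain A B where
        "finite A" "A \<subseteq> T5_V" "\<forall>g\<in>Aut_T5. (\<forall>a\<in>A. g a = a) \<longrightarrow> act g (fst x) = fst x"
        "finite B" "B \<subseteq> T5_V" "\<forall>g\<in>Aut_T5. (\<forall>a\<in>B. g a = a) \<longrightarrow> act g (snd x) = snd x"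
        using stab_open XW[OF x] by metis
      then show ?thesis by (intro exI[of _ "A \<union> B"]) (auto simp: act2_def prod_eq_iff)
    qed
    show "finite {g p |g. g \<in> Aut_T5 \<and> act2 g x = x}" if "x \<in> X" "p \<in> T5_V" for x p
    proof (rule finite_subset)
      show "{g p |g. g \<in> Aut_T5 \<and> act2 g x = x} \<subseteq> {g p |g. g \<in> Aut_T5 \<and> act g (fst x) = fst x}"
        by (auto simp: act2_def prod_eq_iff)
    qed (use stab_compact XW that in blast)
  qed
  interpret arcs: T5_reversible X act2 R prod.swap
  proof
    show "X \<noteq> {}" using vw by (auto simp: X_def)
    show "\<exists>g\<in>Aut_T5. act2 g x = y" if xy: "x \<in> X" "y \<in> X" for x y
    proof -
      obtain f g where "f \<in> Aut_T5" "act2 f x = (v, w)" "g \<in> Aut_T5" "act2 g y = (v, w)"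
        using to_vw xy by metis
      moreover from this have "act2 (inv g) (v, w) = y" using arcs.act_inv(1) xy by metis
      ultimately show ?thesis using arcs.act_comp[OF Aut_T5_inv] xy by (intro bexI[of _ "inv g \<circ> f"]) auto
    qed
    show "R (act2 g x) (act2 g y)" if "g \<in> Aut_T5" "R x y" for g x y
    proof -
      have "act g (snd y) \<noteq> act g (fst x)"
        using that XW act_inv(1)[OF that(1)] unfolding R_def by metis
      then show ?thesis using that arcs.act_in by (simp add: R_def act2_def)
    qed
    have R_eq: "{y. R x y} = Pair (snd x) ` ({u. E (snd x) u} - {fst x})" if "x \<in> X" for x
      using that by (auto simp: R_def X_def)
    have fst_nbr: "fst x \<in> {u. E (snd x) u}" if "x \<in> X" for x using that E_sym by (simp add: XI)
    show "\<exists>y. R x y" if "x \<in> X" for x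
    proof -
      have "card ({u. E (snd x) u} - {fst x}) > 0"
        using card3[OF XW(2)[OF that]] fst_nbr[OF that] finite_nbrs[OF XW(2)[OF that]]
        by (simp add: card_Diff_singleton)
      then have "{u. E (snd x) u} - {fst x} \<noteq> {}" by (metis card.empty less_irrefl)
      then show ?thesis using R_eq[OF that] by blast
    qed
    show "finite {y. R x y} \<and> card {y. R x y} \<le> 3" if "x \<in> X" for x
    proof -
      have "card ({u. E (snd x) u} - {fst x}) \<le> 3"
        using card_nbrs_le[OF XW(2)[OF that]] fst_nbr[OF that] finite_nbrs[OF XW(2)[OF that]]
        by (simp add: card_Diff_singleton)
      moreover have "finite ({u. E (snd x) u} - {fst x})" using finite_nbrs[OF XW(2)[OF that]] by simp
      ultimately show ?thesis unfolding R_eq[OF that] using card_image_le le_trans by blast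
    qed
    show "Y = X" if Y: "Y \<subseteq> X" "Y \<noteq> {}" and clR: "\<And>x y. x \<in> Y \<Longrightarrow> R x y \<Longrightarrow> y \<in> Y"
      and clS: "\<And>x. x \<in> Y \<Longrightarrow> prod.swap x \<in> Y" for Y
    proof -
      \<comment> \<open>Every arc leaving \<open>b\<close> is either the flip of
        \<open>(a, b)\<close> or one of its successors, so the heads of arcs in \<open>Y\<close> are
        closed under adjacency.\<close>
      have out: "(b, d) \<in> Y" if "(a, b) \<in> Y" "E b d" for a b d
      proof (cases "d = a")
        case True
        then show ?thesis using clS[OF that(1)] by simp
      next
        case False
        then have "R (a, b) (b, d)" using that Y by (auto simp: R_def X_def)
        then show ?thesis using clR that by blast
      qed
      have "snd ` Y = W"
      proof (rule E_connected)
        show "snd ` Y \<subseteq> W" using XW Y by blast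
        fix b d assume b: "b \<in> snd ` Y" and bd: "E b d"
        obtain a where "(a, b) \<in> Y" using b by auto
        then have "(b, d) \<in> Y" using out bd by blast
        then show "d \<in> snd ` Y" by (rule image_eqI[rotated]) simp
      qed (use Y in auto)
      have "(c, d) \<in> Y" if cd: "E c d" for c d
      proof -
        have "c \<in> snd ` Y" using \<open>snd ` Y = W\<close> E_in[OF cd] by simp
        then obtain a where "(a, c) \<in> Y" by auto
        then show ?thesis using out cd by blast
      qed
      then show "Y = X" using Y by (auto simp: X_def)
    qed
  qed (use E_sym in \<open>auto simp: R_def X_def act2_def\<close>)
  show False by (rule arcs.absurd)
qed

section \<open>The case of a unique neighbour fixed by the stabilizer\<close>

definition fixed_nbr :: "'v \<Rightarrow> 'v \<Rightarrow> bool" where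
  "fixed_nbr v y \<longleftrightarrow> E v y \<and> (\<forall>u\<in>Aut_T5. act u v = v \<longrightarrow> act u y = y)"

lemma fixed_nbr_act:
  assumes g: "g \<in> Aut_T5" and P: "fixed_nbr v y" shows "fixed_nbr (act g v) (act g y)"
  unfolding fixed_nbr_def
proof (intro conjI ballI impI)
  have vy: "v \<in> W" "y \<in> W" using P E_in by (auto simp: fixed_nbr_def)
  show "E (act g v) (act g y)" using P g E_act by (simp add: fixed_nbr_def)
  fix u assume u: "u \<in> Aut_T5" "act u (act g v) = act g v"
  have "act (inv g \<circ> u \<circ> g) x = act (inv g) (act u (act g x))" if "x \<in> W" for x
    using that g u act_in by (simp add: act_comp Aut_T5_inv Aut_T5_comp)
  then have "act (inv g) (act u (act g y)) = y"
    using P g u vy unfolding fixed_nbr_def by (metis Aut_T5_comp Aut_T5_inv act_inv(1))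
  then show "act u (act g y) = act g y" using g u vy act_in act_inv(2) by metis
qed

text \<open>The unique fixed neighbour defines an equivariant map \<open>s\<close>. Once
  \<open>s\<close> is known to be an involution, paths alternating \<open>s\<close>-edges and other
  edges form a reversible relation with three successors.\<close>

lemma unique_fixed_nbr_absurd:
  assumes vw: "v \<in> W" and card: "card {u. E v u} = 4" and ex1: "\<exists>!y. fixed_nbr v y"
  shows False
proof -
  have ex1_all: "\<exists>!y. fixed_nbr x y" if x: "x \<in> W" for x
  proof -
    obtain g where g: "g \<in> Aut_T5" "act g v = x" using W_transitive vw x by blast
    obtain y0 where y0: "fixed_nbr v y0" using ex1 by blast
    show ?thesis
    proof (rule ex1I)
      show "fixed_nbr x (act g y0)" using fixed_nbr_act g y0 by blast
      fix y assume y: "fixed_nbr x y"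
      then have "fixed_nbr v (act (inv g) y)"
        using fixed_nbr_act[OF Aut_T5_inv[OF g(1)] y] g vw by (metis act_inv(1))
      then have "act (inv g) y = y0" using ex1 y0 by blast
      then show "y = act g y0" using g y E_in act_inv(2) unfolding fixed_nbr_def by metis
    qed
  qed
  define s where "s x = (THE y. fixed_nbr x y)" for x
  have s: "fixed_nbr x (s x)" if "x \<in> W" for x
    unfolding s_def using ex1_all[OF that] by (rule theI')
  have s_eq: "s x = y" if "fixed_nbr x y" for x y
    using that ex1_all s E_in unfolding fixed_nbr_def by metis
  have sE: "E x (s x)" "s x \<in> W" if "x \<in> W" for x
    using s[OF that] E_in by (auto simp: fixed_nbr_def)
  have s_stab: "act u (s x) = s x" if "x \<in> W" "u \<in> Aut_T5" "act u x = x" for x u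
    using s that by (simp add: fixed_nbr_def)
  have s_act: "s (act g x) = act g (s x)" if "g \<in> Aut_T5" "x \<in> W" for g x
    using s_eq fixed_nbr_act s that by blast
  have s_invol: "s (s x) = x" if x: "x \<in> W" for x
  proof (rule ccontr)
    assume ne: "s (s x) \<noteq> x"
    define y where "y = s x"
    have y: "y \<in> W" "E y x" using sE[OF x] E_sym by (auto simp: y_def)
    obtain h where h: "h \<in> Aut_T5" "act h y = x" using W_transitive x y by blast
    \<comment> \<open>The stabilizer of \<open>y\<close> fixes \<open>s y\<close>, so it cannot move
      \<open>x\<close> there. At most three of the four neighbours remain, and \<open>h\<close>
      becomes periodic at \<open>y\<close>.\<close>
    have sub: "suborbit y x \<subseteq> {u. E y u} - {s y}"
    proof -
      have "act u x \<noteq> s y" if u: "u \<in> Aut_T5" "act u y = y" for u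
      proof
        assume eq: "act u x = s y"
        have "act (inv u) y = y" using u y act_inv(1) by metis
        then have "act (inv u) (s y) = s y" using s_stab y u by blast
        then have "x = s y" using eq u x act_inv(1) by metis
        then show False using ne by (simp add: y_def)
      qed
      then show ?thesis using suborbit_sub[OF y(2)] by (auto simp: suborbit_def)
    qed
    have "card ({u. E y u} - {s y}) \<le> 3"
      using card_nbrs_le[OF y(1)] sE(1)[OF y(1)] finite_nbrs[OF y(1)] by (simp add: card_Diff_singleton)
    moreover have fin: "finite ({u. E y u} - {s y})" using finite_nbrs[OF y(1)] by simp
    ultimately have "card (suborbit y x) \<le> 3" using card_mono[OF _ sub] le_trans by blast
    moreover have "finite (suborbit y x)" using fin sub finite_subset by blast
    ultimately obtain m where m: "m > 0" "act (h ^^ m) y = y"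
      using small_suborbit_periodic[OF h(1) y(1)] h(2) unfolding suborbit_def by metis
    have "fixed_nbr y x" unfolding fixed_nbr_def
    proof (intro conjI ballI impI y(2))
      fix u assume u: "u \<in> Aut_T5" "act u y = y"
      \<comment> \<open>Equivariance and \<open>act h y = x\<close> with \<open>s x = y\<close>: the
        map \<open>s\<close> walks the cycle of \<open>h\<close> backwards.\<close>
      have s_pow: "s (act (h ^^ Suc i) y) = act (h ^^ i) y" for i
        using act_funpow_Suc[OF h(1) y(1)] h(2) s_act Aut_T5_funpow h(1) x y_def by metis
      \<comment> \<open>Downward induction from \<open>Suc i = m\<close>, where the point is
        \<open>y\<close>, to \<open>i = 0\<close>, where it is \<open>x\<close>. Thus the stabilizer
        of \<open>y\<close> fixes \<open>x\<close>, which forces \<open>s y = x\<close>.\<close>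
      have "act u (act (h ^^ Suc i) y) = act (h ^^ Suc i) y" if "Suc i \<le> m" for i
        using that
      proof (induction "m - Suc i" arbitrary: i)
        case 0
        then have "Suc i = m" by simp
        then show ?case using m u by metis
      next
        case (Suc d)
        have IH: "act u (act (h ^^ Suc (Suc i)) y) = act (h ^^ Suc (Suc i)) y"
          by (rule Suc.hyps(1)) (use Suc.hyps(2) in simp_all)
        have "act (h ^^ Suc (Suc i)) y \<in> W" using act_in Aut_T5_funpow h y by blast
        from s_stab[OF this u(1) IH] show ?case by (simp only: s_pow)
      qed
      from this[of 0] show "act u x = x" using m h by simp
    qed
    then show False using s_eq ne by (auto simp: y_def)
  qed
  \<comment> \<open>One step crosses the \<open>s\<close>-edge from \<open>x\<close> and then an
    edge at \<open>s x\<close> other than the one back to \<open>x\<close>.\<close>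
  define R where "R x y \<longleftrightarrow> x \<in> W \<and> E (s x) y \<and> y \<noteq> x" for x y
  have R_eq: "{y. R x y} = {u. E (s x) u} - {x}" if "x \<in> W" for x
    using that by (auto simp: R_def)
  have R_card: "finite {y. R x y} \<and> card {y. R x y} = 3" if "x \<in> W" for x
    using card_nbrs_eq[OF sE(2)[OF that] vw] card E_sym[OF sE(1)[OF that]] finite_nbrs[OF sE(2)[OF that]]
    by (simp add: R_eq[OF that] card_Diff_singleton)
  interpret T5_reversible W act R s
  proof
    show "\<exists>y. R x y" if "x \<in> W" for x
    proof -
      have "{y. R x y} \<noteq> {}" using R_card[OF that] by (metis card.empty zero_neq_numeral)
      then show ?thesis by blast
    qed
    show "finite {y. R x y} \<and> card {y. R x y} \<le> 3" if "x \<in> W" for x using R_card[OF that] by simp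
    show "R (act g x) (act g y)" if "g \<in> Aut_T5" "R x y" for g x y
    proof -
      have xy: "x \<in> W" "y \<in> W" "E (s x) y" "y \<noteq> x" using that E_in by (auto simp: R_def)
      then have "act g y \<noteq> act g x" using act_inv(1)[OF that(1)] by metis
      then show ?thesis using xy that E_act s_act act_in by (simp add: R_def)
    qed
    show "R (s y) (s x)" if "R x y" for x y
    proof -
      have xy: "x \<in> W" "y \<in> W" "E (s x) y" "y \<noteq> x" using that E_in by (auto simp: R_def)
      then have "s x \<noteq> s y" using s_invol by metis
      then show ?thesis using xy s_invol sE E_sym by (simp add: R_def)
    qed
    show "Y = W" if Y: "Y \<subseteq> W" "Y \<noteq> {}" and clR: "\<And>x y. x \<in> Y \<Longrightarrow> R x y \<Longrightarrow> y \<in> Y"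
      and clS: "\<And>x. x \<in> Y \<Longrightarrow> s x \<in> Y" for Y
    proof (rule E_connected[OF Y])
      fix x y assume x: "x \<in> Y" and xy: "E x y"
      show "y \<in> Y"
      \<comment> \<open>A neighbour of \<open>x\<close> is \<open>s x\<close> or an
        \<open>R\<close>-successor of \<open>s x\<close>, because
        \<open>s (s x) = x\<close>.\<close>
      proof (cases "y = s x")
        case True
        then show ?thesis using clS x by simp
      next
        case False
        then have "R (s x) y" using x xy Y sE s_invol by (auto simp: R_def)
        then show ?thesis using clR clS x by blast
      qed
    qed
  qed (use W_nonempty W_transitive E_in sE s_invol s_act in \<open>auto simp: R_def\<close>)
  show False by (rule absurd)
qed

text \<open>A suborbit with at least three of at most four neighbours is either everything, which is
  the arc-transitive case, or leaves one neighbour over. The stabilizer preserves the complement, so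
  it fixes that neighbour.\<close>

lemma small_absurd: False
proof -
  obtain v w where vw: "E v w" and card: "3 \<le> card (suborbit v w)"
    using ex_large_suborbit by blast
  have v: "v \<in> W" "w \<in> W" using E_in[OF vw] by auto
  note fin = finite_nbrs[OF v(1)]
  have sub: "suborbit v w \<subseteq> {u. E v u}" using suborbit_sub[OF vw] .
  have le: "card (suborbit v w) \<le> card {u. E v u}" using card_mono[OF fin sub] .
  have ne: "suborbit v w \<noteq> {u. E v u}"
    using arc_transitive_absurd[OF vw] card le by auto
  then have "card (suborbit v w) < card {u. E v u}" using sub fin by (meson psubsetI psubset_card_mono)
  then have c: "card {u. E v u} = 4" "card (suborbit v w) = 3" using card card_nbrs_le[OF v(1)] by auto
  have "card ({u. E v u} - suborbit v w) = 1"
    using card_Diff_subset[OF finite_subset[OF sub fin] sub] c by simp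
  then obtain y where y: "{u. E v u} - suborbit v w = {y}" by (auto simp: card_1_singleton_iff)
  have yE: "E v y" "y \<notin> suborbit v w" using y by auto
  have "fixed_nbr v y"
    unfolding fixed_nbr_def
  proof (intro conjI ballI impI yE(1))
    fix u assume u: "u \<in> Aut_T5" "act u v = v"
    have "act u y \<notin> suborbit v w"
    proof
      assume "act u y \<in> suborbit v w"
      then obtain k where k: "k \<in> Aut_T5" "act k v = v" "act k w = act u y"
        by (auto simp: suborbit_def)
      have "act (inv u) v = v" using u v act_inv(1) by metis
      then have "act (inv u \<circ> k) v = v" "act (inv u \<circ> k) w = y"
        using k u v E_in[OF yE(1)] by (simp_all add: act_comp Aut_T5_inv)
      then have "y \<in> suborbit v w" using k u unfolding suborbit_def by blast
      then show False using yE by blast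
    qed
    moreover have "E v (act u y)" using E_act[OF u(1) yE(1)] u(2) by simp
    ultimately show "act u y = y" using y by blast
  qed
  \<comment> \<open>Another fixed neighbour would lie in the suborbit of size 3 and collapse it to
    one point.\<close>
  moreover have "z = y" if z: "fixed_nbr v z" for z
  proof (rule ccontr)
    assume "z \<noteq> y"
    then have "z \<in> suborbit v w" using z y by (auto simp: fixed_nbr_def)
    then obtain k where k: "k \<in> Aut_T5" "act k v = v" "act k w = z" by (auto simp: suborbit_def)
    have "act (inv k) v = v" using k v act_inv(1) by metis
    then have "act (inv k) z = z" using z k by (auto simp: fixed_nbr_def)
    then have "w = z" using k v act_inv(1) by metis
    then have "suborbit v w \<subseteq> {w}" using z by (auto simp: fixed_nbr_def suborbit_def)
    then have "card (suborbit v w) \<le> 1" using card_mono[of "{w}"] by simp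
    then show False using card by simp
  qed
  ultimately show False using unique_fixed_nbr_absurd[OF v(1) c(1)] by blast
qed

end

lemma cayley_abels_degree_ge:
  assumes ca: "cayley_abels_graph Aut_T5 T5_top W E act" and v: "v \<in> W"
  shows "5 \<le> degree E v"
proof (rule ccontr)
  assume "\<not> 5 \<le> degree E v"
  then interpret T5_small_graph W E act
    using ca v by unfold_locales (auto intro!: bexI[of _ v])
  show False by (rule small_absurd)
qed

theorem theorem6p1:
  shows "cayley_abels_graph Aut_T5 T5_top T5_V T5_adj (\<lambda>g. g)
       \<and> (\<forall>v\<in>T5_V. degree T5_adj v = 5)
       \<and> (\<forall>(W :: 'v set) E act. cayley_abels_graph Aut_T5 T5_top W E act
             \<longrightarrow> (\<forall>v\<in>W. 5 \<le> degree E v))"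
  by (intro conjI allI ballI impI T5_cayley_abels T5_degree(2) cayley_abels_degree_ge)

end
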